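(* Let $\mathfrak B$ be a Banach space, $f\in C(\mathbb R,\mathfrak B)$, $F\in C(\mathbb R\times\mathfrak B,\mathfrak B)$ with $F(t,0)=0$ for all $t\in\mathbb R$, and $A\in C(\mathbb R,[\mathfrak B])$. Assume: 1) the linear equation $x'=A(t)x$ has an exponential trichotomy on $\mathbb R$ with constants $\mathcal N\ge1$, $\nu>0$; 2) the functions $A$, $f$ and $F$ are Lagrange stable; 3) $F$ satisfies $|F(t,u_1)-F(t,u_2)|\le L|u_1-u_2|$ for all $t\in\mathbb R$, $u_1,u_2\in\mathfrak B$, with a constant $L<\frac{\nu}{2\mathcal N}$. Let $\varphi_0(t):=\int_{-\infty}^{+\infty}G_A(t,\tau)f(\tau)\,d\tau$ be the corresponding bounded solution of $x'=A(t)x+f(t)$, where $G_A$ is the Green function associated with the trichotomy. Then the equation $u'=A(t)u+f(t)+F(t,u)$ has at least one Lagrange stable solution $\varphi$ on $\mathbb R$ satisfying $$\varphi(t)=\int_{-\infty}^{+\infty}G_A(t,\tau)\bigl(f(\tau)+F(\tau,\varphi(\tau))\bigr)\,d\tau\quad(t\in\mathbb R)$$ and $$\|\varphi-\varphi_0\|\le r,\qquad r:=\frac{4\mathcal N^2L\|f\|}{\nu(\nu-2\mathcal N L)}.$$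
   Context: $\mathfrak B$ is a real or complex Banach space with norm $|\cdot|$; $[\mathfrak B]$ is the Banach space of bounded linear operators on $\mathfrak B$ with the operator norm; $\|g\|:=\sup_{t\in\mathbb R}|g(t)|$ for bounded $g:\mathbb R\to\mathfrak B$. For a metric space $E$, $C(\mathbb R,E)$ carries the topology of uniform convergence on compact sets, and $C(\mathbb R\times\mathfrak B,\mathfrak B)$ carries the compact-open topology; $g^h(t):=g(t+h)$ and $F^h(t,x):=F(t+h,x)$. A function $g$ in one of these spaces is Lagrange stable if the set of its translates $\{g^h:h\in\mathbb R\}$ is precompact in that space. $U(t,A)$ denotes the Cauchy operator of $x'=A(t)x$ (so $U(0,A)=I$ and $t\mapsto U(t,A)x$ is the solution with value $x$ at $t=0$). The equation $x'=A(t)x$ has an exponential trichotomy on $\mathbb R$ with constants $\mathcal N\ge1$, $\nu>0$ if there are bounded linear projections $P,Q$ on $\mathfrak B$ with $PQ=QP$, $P+Q-PQ=I$ and $\|U(t,A)PU^{-1}(\tau,A)\|\le\mathcal N e^{-\nu(t-\tau)}$ for $0\le\tau\le t$; $\|U(t,A)(I-P)U^{-1}(\tau,A)\|\le\mathcal N e^{-\nu(\tau-t)}$ for $t\le\tau$, $\tau\ge0$; $\|U(t,A)QU^{-1}(\tau,A)\|\le\mathcal N e^{-\nu(\tau-t)}$ for $t\le\tau\le0$; $\|U(t,A)(I-Q)U^{-1}(\tau,A)\|\le\mathcal N e^{-\nu(t-\tau)}$ for $\tau\le t$, $\tau\le0$. The associated Green function is: $G_A(t,\tau)=U(t,A)PU^{-1}(\tau,A)$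 if $0\le\tau<t$; $G_A(t,\tau)=-U(t,A)(I-P)U^{-1}(\tau,A)$ if $t\le\tau$, $\tau\ge0$; $G_A(t,\tau)=-U(t,A)QU^{-1}(\tau,A)$ if $t\le\tau\le0$; $G_A(t,\tau)=U(t,A)(I-Q)U^{-1}(\tau,A)$ if $\tau\le t$, $\tau\le0$ (the cases overlap only for $\tau=0$ or $\tau=t$, which does not affect the integral). *)

theory Defs
  imports "HOL-Analysis.Analysis"
begin

text \<open>The ambient space is a type of class \<^class>\<open>banach\<close>, a real Banach space. This includes complex
  Banach spaces: complex-linear bounded operators form a closed subspace of the real-linear
  ones, with the same norm, and complex linearity does not occur otherwise.\<close>

subsection \<open>Function spaces and Lagrange stability\<close>

definition ucc_open :: "('x::topological_space \<Rightarrow> 'y::metric_space) set \<Rightarrow> bool" where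
  "ucc_open W \<longleftrightarrow> W \<subseteq> {g. continuous_on UNIV g} \<and>
     (\<forall>g\<in>W. \<exists>K e. compact K \<and> 0 < e \<and>
        {h. continuous_on UNIV h \<and> (\<forall>x\<in>K. dist (h x) (g x) < e)} \<subseteq> W)"

text \<open>Continuous functions with the topology of uniform convergence on compact sets.\<close>
definition ucc_topology :: "('x::topological_space \<Rightarrow> 'y::metric_space) topology" where
  "ucc_topology = topology ucc_open"

lemma ucc_openE:
  assumes "ucc_open W" "g \<in> W"
  obtains K e where "compact K" "0 < e"
    "{h. continuous_on UNIV h \<and> (\<forall>x\<in>K. dist (h x) (g x) < e)} \<subseteq> W"
proof -
  from assms(1) have "\<forall>g\<in>W. \<exists>K e. compact K \<and> 0 < e \<and>
      {h. continuous_on UNIV h \<and> (\<forall>x\<in>K. dist (h x) (g x) < e)} \<subseteq> W"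
    unfolding ucc_open_def by (rule conjunct2)
  from bspec[OF this assms(2)] show thesis
    by (elim exE conjE) (rule that)
qed

lemma ucc_open_subset: "ucc_open W \<Longrightarrow> W \<subseteq> {g. continuous_on UNIV g}"
  unfolding ucc_open_def by (rule conjunct1)

lemma istopology_ucc_open:
  "istopology (ucc_open :: ('x::topological_space \<Rightarrow> 'y::metric_space) set \<Rightarrow> bool)"
  unfolding istopology_def
proof (intro conjI allI impI)
  fix S T :: "('x \<Rightarrow> 'y) set"
  assume S: "ucc_open S" and T: "ucc_open T"
  show "ucc_open (S \<inter> T)"
    unfolding ucc_open_def
  proof (intro conjI ballI)
    show "S \<inter> T \<subseteq> {g. continuous_on UNIV g}"
      using ucc_open_subset[OF S] by (rule le_infI1)
    fix g assume g: "g \<in> S \<inter> T"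
    from g have gS: "g \<in> S" and gT: "g \<in> T" by simp_all
    obtain K e where 1: "compact K" "0 < e"
      "{h. continuous_on UNIV h \<and> (\<forall>x\<in>K. dist (h x) (g x) < e)} \<subseteq> S"
      by (rule ucc_openE[OF S gS])
    obtain K' e' where 2: "compact K'" "0 < e'"
      "{h. continuous_on UNIV h \<and> (\<forall>x\<in>K'. dist (h x) (g x) < e')} \<subseteq> T"
      by (rule ucc_openE[OF T gT])
    have "compact (K \<union> K')" "0 < min e e'"
      using 1(1,2) 2(1,2) by (simp_all add: compact_Un)
    moreover have "{h. continuous_on UNIV h \<and> (\<forall>x\<in>K \<union> K'. dist (h x) (g x) < min e e')} \<subseteq> S \<inter> T"
    proof (rule subsetI)
      fix h assume "h \<in> {h. continuous_on UNIV h \<and> (\<forall>x\<in>K \<union> K'. dist (h x) (g x) < min e e')}"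
      then have "h \<in> {h. continuous_on UNIV h \<and> (\<forall>x\<in>K. dist (h x) (g x) < e)}"
        "h \<in> {h. continuous_on UNIV h \<and> (\<forall>x\<in>K'. dist (h x) (g x) < e')}"
        by simp_all
      with 1(3) 2(3) show "h \<in> S \<inter> T" by (intro IntI) (erule (1) subsetD)+
    qed
    ultimately show "\<exists>K e. compact K \<and> 0 < e \<and>
        {h. continuous_on UNIV h \<and> (\<forall>x\<in>K. dist (h x) (g x) < e)} \<subseteq> S \<inter> T"
      by (intro exI[of _ "K \<union> K'"] exI[of _ "min e e'"] conjI)
  qed
next
  fix \<K> :: "('x \<Rightarrow> 'y) set set"
  assume *: "\<forall>S\<in>\<K>. ucc_open S"
  show "ucc_open (\<Union>\<K>)"
    unfolding ucc_open_def
  proof (intro conjI ballI)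
    show "\<Union>\<K> \<subseteq> {g. continuous_on UNIV g}"
      using * by (intro Union_least ucc_open_subset) simp
    fix g assume "g \<in> \<Union>\<K>"
    then obtain S where S: "S \<in> \<K>" "g \<in> S" by (rule UnionE)
    with * have "ucc_open S" by simp
    obtain K e where K: "compact K" "0 < e"
      "{h. continuous_on UNIV h \<and> (\<forall>x\<in>K. dist (h x) (g x) < e)} \<subseteq> S"
      by (rule ucc_openE[OF \<open>ucc_open S\<close> S(2)])
    have "S \<subseteq> \<Union>\<K>" using S(1) by (rule Union_upper)
    with K(3) have "{h. continuous_on UNIV h \<and> (\<forall>x\<in>K. dist (h x) (g x) < e)} \<subseteq> \<Union>\<K>"
      by (rule subset_trans)
    with K(1,2) show "\<exists>K e. compact K \<and> 0 < e \<and>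
        {h. continuous_on UNIV h \<and> (\<forall>x\<in>K. dist (h x) (g x) < e)} \<subseteq> \<Union>\<K>"
      by (intro exI[of _ K] exI[of _ e] conjI)
  qed
qed

lemma openin_ucc_topology: "openin ucc_topology W \<longleftrightarrow> ucc_open W"
  unfolding ucc_topology_def by (simp only: topology_inverse'[OF istopology_ucc_open])

lemma topspace_ucc_topology:
  "topspace (ucc_topology :: ('x::topological_space \<Rightarrow> 'y::metric_space) topology) =
     {g. continuous_on UNIV g}"
proof (rule subset_antisym)
  have "ucc_open (topspace (ucc_topology :: ('x \<Rightarrow> 'y) topology))"
    by (rule iffD1[OF openin_ucc_topology openin_topspace])
  then show "topspace (ucc_topology :: ('x \<Rightarrow> 'y) topology) \<subseteq> {g. continuous_on UNIV g}"
    by (rule ucc_open_subset)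
  have "\<exists>K e. compact K \<and> 0 < e \<and>
      {h. continuous_on UNIV h \<and> (\<forall>x\<in>K. dist (h x) (g x) < e)} \<subseteq> {h. continuous_on UNIV h}"
    for g :: "'x \<Rightarrow> 'y"
  proof (rule exI[of _ "{}"], rule exI[of _ 1], intro conjI)
    show "{h. continuous_on UNIV h \<and> (\<forall>x\<in>{}. dist (h x) (g x) < 1)} \<subseteq> {h. continuous_on UNIV h}"
      by (rule Collect_mono) (rule impI, erule conjunct1)
  qed (rule compact_empty, rule zero_less_one)
  then have "ucc_open {g :: 'x \<Rightarrow> 'y. continuous_on UNIV g}"
    unfolding ucc_open_def by (intro conjI ballI subset_refl)
  then show "{g. continuous_on UNIV g} \<subseteq> topspace (ucc_topology :: ('x \<Rightarrow> 'y) topology)"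
    by (rule openin_subset[OF iffD2[OF openin_ucc_topology]])
qed

definition compact_open_topology :: "('x::topological_space \<Rightarrow> 'y::topological_space) topology" where
  "compact_open_topology = topology_generated_by
     {{g. continuous_on UNIV g \<and> g ` K \<subseteq> V} | K V. compact K \<and> open V}"

lemma topspace_compact_open_topology:
  "topspace (compact_open_topology :: ('x::topological_space \<Rightarrow> 'y::topological_space) topology) =
     {g. continuous_on UNIV g}" (is "_ = ?C")
proof -
  let ?B = "{{g :: 'x \<Rightarrow> 'y. continuous_on UNIV g \<and> g ` K \<subseteq> V} | K V. compact K \<and> open V}"
  have "?C \<in> ?B"
    by (rule CollectI, rule exI[of _ "{}"], rule exI[of _ "UNIV"])
      (simp only: image_empty empty_subsetI compact_empty open_UNIV simp_thms)
  then have "?C \<subseteq> \<Union>?B" by (rule Union_upper)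
  moreover have "\<Union>?B \<subseteq> ?C"
  proof (rule Union_least)
    fix X assume "X \<in> ?B"
    then obtain K V where "X = {g. continuous_on UNIV g \<and> g ` K \<subseteq> V}"
      by (elim CollectE exE conjE) (rule that)
    then show "X \<subseteq> ?C" by (simp only: Collect_mono_iff) (intro allI impI, erule conjunct1)
  qed
  ultimately have "\<Union>?B = ?C" by (intro subset_antisym)
  then show ?thesis
    unfolding compact_open_topology_def topology_generated_by_topspace .
qed

text \<open>Precompact means having compact closure. The inclusion in the carrier is needed
  because \<^const>\<open>closure_of\<close> discards points outside the carrier.\<close>
definition precompact_in :: "'x topology \<Rightarrow> 'x set \<Rightarrow> bool" where
  "precompact_in X S \<longleftrightarrow> S \<subseteq> topspace X \<and> compactin X (X closure_of S)"

definition lagrange_stable :: "(real \<Rightarrow> 'y::metric_space) \<Rightarrow> bool" where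
  "lagrange_stable g \<longleftrightarrow> precompact_in ucc_topology (range (\<lambda>h t. g (t + h)))"

definition lagrange_stable2 :: "(real \<times> 'x::topological_space \<Rightarrow> 'y::topological_space) \<Rightarrow> bool" where
  "lagrange_stable2 F \<longleftrightarrow>
     precompact_in compact_open_topology (range (\<lambda>h (t, x). F (t + h, x)))"

text \<open>Meaningful for bounded functions only.\<close>
definition sup_norm :: "(real \<Rightarrow> 'a::real_normed_vector) \<Rightarrow> real" where
  "sup_norm g = (SUP t. norm (g t))"

subsection \<open>Differential equations, trichotomy and Green function\<close>

definition solves_on_reals :: "(real \<Rightarrow> 'a::real_normed_vector) \<Rightarrow> (real \<Rightarrow> 'a \<Rightarrow> 'a) \<Rightarrow> bool" where
  "solves_on_reals u X \<longleftrightarrow> (\<forall>t. (u has_vector_derivative X t (u t)) (at t))"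

text \<open>\<open>cauchy_op A t\<close> is $U(t,A)$; existence and uniqueness hold for continuous \<open>A\<close>.\<close>
definition cauchy_op :: "(real \<Rightarrow> 'a::banach \<Rightarrow>\<^sub>L 'a) \<Rightarrow> real \<Rightarrow> 'a \<Rightarrow>\<^sub>L 'a" where
  "cauchy_op A = (THE U. U 0 = id_blinfun \<and>
     (\<forall>x. solves_on_reals (\<lambda>t. blinfun_apply (U t) x) (\<lambda>t. blinfun_apply (A t))))"

definition cauchy_op_inv :: "(real \<Rightarrow> 'a::banach \<Rightarrow>\<^sub>L 'a) \<Rightarrow> real \<Rightarrow> 'a \<Rightarrow>\<^sub>L 'a" where
  "cauchy_op_inv A t = Blinfun (inv (blinfun_apply (cauchy_op A t)))"

definition transported ::
  "(real \<Rightarrow> 'a::banach \<Rightarrow>\<^sub>L 'a) \<Rightarrow> 'a \<Rightarrow>\<^sub>L 'a \<Rightarrow> real \<Rightarrow> real \<Rightarrow> 'a \<Rightarrow>\<^sub>L 'a" where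
  "transported A R t \<tau> = cauchy_op A t o\<^sub>L R o\<^sub>L cauchy_op_inv A \<tau>"

text \<open>Exponential trichotomy on the real line with constants \<open>N\<close>, \<open>\<nu>\<close>, witnessed by the
  projections \<open>P\<close> and \<open>Q\<close>, which also enter the Green function.\<close>
definition exp_trichotomy ::
  "(real \<Rightarrow> 'a::banach \<Rightarrow>\<^sub>L 'a) \<Rightarrow> 'a \<Rightarrow>\<^sub>L 'a \<Rightarrow> 'a \<Rightarrow>\<^sub>L 'a \<Rightarrow> real \<Rightarrow> real \<Rightarrow> bool" where
  "exp_trichotomy A P Q N \<nu> \<longleftrightarrow>
     1 \<le> N \<and> 0 < \<nu> \<and>
     P o\<^sub>L P = P \<and> Q o\<^sub>L Q = Q \<and> P o\<^sub>L Q = Q o\<^sub>L P \<and> P + Q - (P o\<^sub>L Q) = id_blinfun \<and>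
     (\<forall>t \<tau>. 0 \<le> \<tau> \<and> \<tau> \<le> t \<longrightarrow>
        norm (transported A P t \<tau>) \<le> N * exp (- \<nu> * (t - \<tau>))) \<and>
     (\<forall>t \<tau>. t \<le> \<tau> \<and> 0 \<le> \<tau> \<longrightarrow>
        norm (transported A (id_blinfun - P) t \<tau>) \<le> N * exp (- \<nu> * (\<tau> - t))) \<and>
     (\<forall>t \<tau>. t \<le> \<tau> \<and> \<tau> \<le> 0 \<longrightarrow>
        norm (transported A Q t \<tau>) \<le> N * exp (- \<nu> * (\<tau> - t))) \<and>
     (\<forall>t \<tau>. \<tau> \<le> t \<and> \<tau> \<le> 0 \<longrightarrow>
        norm (transported A (id_blinfun - Q) t \<tau>) \<le> N * exp (- \<nu> * (t - \<tau>)))"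

text \<open>The usual four cases overlap for \<open>\<tau> = 0\<close> or \<open>\<tau> = t\<close> only, which does not affect
  integrals over \<open>\<tau>\<close>; there the first applicable case is taken.\<close>
definition green ::
  "(real \<Rightarrow> 'a::banach \<Rightarrow>\<^sub>L 'a) \<Rightarrow> 'a \<Rightarrow>\<^sub>L 'a \<Rightarrow> 'a \<Rightarrow>\<^sub>L 'a \<Rightarrow> real \<Rightarrow> real \<Rightarrow> 'a \<Rightarrow>\<^sub>L 'a" where
  "green A P Q t \<tau> =
     (if 0 \<le> \<tau> \<and> \<tau> < t then transported A P t \<tau>
      else if t \<le> \<tau> \<and> 0 \<le> \<tau> then - transported A (id_blinfun - P) t \<tau>
      else if t \<le> \<tau> \<and> \<tau> \<le> 0 then - transported A Q t \<tau>
      else transported A (id_blinfun - Q) t \<tau>)"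

end

theory Submission
  imports Defs
begin

text \<open>Since \<open>A\<close> is Lagrange stable it is bounded, the Cauchy operator exists, and the Green function
  satisfies \<open>|G(t, \<tau>)| \<le> N exp (- \<nu> \<bar>t - \<tau>\<bar>)\<close>. Hence \<open>\<phi> \<mapsto> \<integral> G(\<cdot>, \<tau>) (f(\<tau>) + F(\<tau>, \<phi>(\<tau>))) d\<tau>\<close> is a contraction
  with constant \<open>2 N L / \<nu> < 1\<close> for the sup norm. It is applied on the closed set of Lagrange stable
  functions, so what is left is that the Green integral \<open>\<psi>\<close> of a Lagrange stable \<open>g\<close> is Lagrange
  stable. Bounded solutions of a trichotomic equation are not unique, but any two of them differ by
  at most a multiple of \<open>exp (- \<nu> \<bar>t\<bar>)\<close>. The difference of \<open>\<psi>\<close> and its translate by \<open>s\<close> is a bounded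
  solution with inhomogeneity \<open>(A(t) - A(t + s)) \<psi>(t + s) + g(t) - g(t + s)\<close>, so around a distant
  point \<open>h\<close> it is small as soon as the translates of \<open>A\<close> and \<open>g\<close> by \<open>h\<close> and \<open>h + s\<close> are close on a
  large interval. Total boundedness of the translates of \<open>A\<close> and \<open>g\<close> therefore passes to \<open>\<psi>\<close>.\<close>

subsection \<open>Linear differential equations with bounded coefficients\<close>

lemma antiderivative_on_reals:
  fixes k :: "real \<Rightarrow> 'e::banach"
  assumes "continuous_on UNIV k"
  obtains K where "K 0 = 0" "\<And>t. (K has_vector_derivative k t) (at t)"
proof -
  \<comment> \<open>For either sign of \<open>t\<close> one of the two intervals is empty or a
    single point, so the difference is the oriented integral from 0 to \<open>t\<close>.\<close>
  define K where "K t = integral {0..t} k - integral {t..0} k" for t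
  have int: "k integrable_on {a..b}" for a b
    using assms by (intro integrable_continuous_interval) (auto intro: continuous_on_subset)
  have "(K has_vector_derivative k t) (at t)" for t
  proof -
    define a b where "a = min 0 t - 1" and "b = max 0 t + 1"
    have K_eq: "K s = integral {a..s} k - integral {a..0} k" if "s \<in> {a<..<b}" for s
    proof (cases "s \<ge> 0")
      case True
      then have "integral {a..0} k + integral {0..s} k = integral {a..s} k"
        using int by (intro Henstock_Kurzweil_Integration.integral_combine) (auto simp: a_def)
      moreover have "integral {s..0} k = 0" using True by (cases "s = 0") auto
      ultimately show ?thesis by (simp add: K_def algebra_simps)
    next
      case False
      then have "integral {a..s} k + integral {s..0} k = integral {a..0} k"
        using int that by (intro Henstock_Kurzweil_Integration.integral_combine) auto
      then show ?thesis using False by (simp add: K_def algebra_simps)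
    qed
    have "((\<lambda>s. integral {a..s} k - integral {a..0} k) has_vector_derivative k t) (at t)"
    proof -
      have "((\<lambda>s. integral {a..s} k) has_vector_derivative k t) (at t within {a..b})"
        using assms by (intro integral_has_vector_derivative)
          (auto intro: continuous_on_subset simp: a_def b_def)
      then have "((\<lambda>s. integral {a..s} k) has_vector_derivative k t) (at t)"
        by (subst (asm) at_within_interior) (auto simp: a_def b_def interior_atLeastAtMost_real)
      then show ?thesis by (auto intro!: derivative_eq_intros)
    qed
    from this open_greaterThanLessThan show ?thesis
    proof (rule has_vector_derivative_transform_within_open)
      show "t \<in> {a<..<b}" by (auto simp: a_def b_def)
    qed (simp add: K_eq)
  qed
  moreover have "K 0 = 0" by (simp add: K_def)
  ultimately show thesis by (rule that[rotated])
qed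

text \<open>Integrating the weight \<open>exp (2 * b * s)\<close> divides by \<open>2 * b\<close>,
  which turns the factor \<open>b\<close> into \<open>1 / 2\<close>. This gain makes the Picard
  operator a contraction in the weighted norm of the next lemma.\<close>

lemma norm_le_of_exponential_derivative_bound:
  fixes K :: "real \<Rightarrow> 'e::real_normed_vector"
  assumes "K 0 = 0" and K': "\<And>t. (K has_vector_derivative k t) (at t)"
    and k: "\<And>t. norm (k t) \<le> M * b * exp (2 * b * \<bar>t\<bar>)" and M: "0 \<le> M"
  shows "norm (K t) \<le> M / 2 * exp (2 * b * \<bar>t\<bar>)"
proof -
  have *: "norm (H t) \<le> M / 2 * exp (2 * b * t)"
    if H: "H 0 = 0" "\<And>t. (H has_vector_derivative h t) (at t)"
      "\<And>t. norm (h t) \<le> M * b * exp (2 * b * \<bar>t\<bar>)" and "t > 0"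
    for H :: "real \<Rightarrow> 'e" and h t
  proof -
    have "norm (H t - H 0) \<le> M / 2 * exp (2 * b * t) - M / 2 * exp (2 * b * 0)"
    proof (rule differentiable_bound_general[OF \<open>t > 0\<close>])
      show "continuous_on {0..t} H"
        using H(2) by (meson continuous_at_imp_continuous_on has_vector_derivative_continuous)
      show "norm (h x) \<le> M * b * exp (2 * b * x)" if "0 < x" for x
        using H(3)[of x] that by simp
      show "((\<lambda>t. M / 2 * exp (2 * b * t)) has_vector_derivative M * b * exp (2 * b * x)) (at x)" for x
        by (auto intro!: derivative_eq_intros simp flip: has_real_derivative_iff_has_vector_derivative)
    qed (auto intro!: continuous_intros H)
    then show ?thesis using H(1) M by simp
  qed
  consider "t = 0" | "t > 0" | "t < 0" by linarith
  then show ?thesis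
  proof cases
    case 1 then show ?thesis using assms(1) M by simp
  next
    case 2 then show ?thesis using *[OF assms(1) K' k] by simp
  next
    case 3
    have "((\<lambda>t. K (- t)) has_vector_derivative - k (- t)) (at t)" for t
      using vector_diff_chain_at[of uminus "-1" t K "k (-t)"] K'[of "-t"]
        has_vector_derivative_minus[OF has_vector_derivative_id, of "at t"]
      by (simp add: o_def)
    from *[OF _ this, of "- t"] 3 assms(1) k[of "- s" for s] show ?thesis by simp
  qed
qed

text \<open>Global Picard iteration in Bielecki's supremum norm with weight
  \<open>exp (- 2 * b * |t|)\<close>: the integral operator contracts on the whole line at once, so
  no local solutions have to be glued. The space is an arbitrary Banach space because the unknowns
  will be operator-valued.\<close>

lemma lipschitz_ode_exists:
  fixes h :: "real \<Rightarrow> 'e::banach \<Rightarrow> 'e"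
  assumes cont_h: "\<And>V. continuous_on UNIV V \<Longrightarrow> continuous_on UNIV (\<lambda>t. h t (V t))"
    and lip_h: "\<And>t x y. norm (h t x - h t y) \<le> \<beta> * norm (x - y)"
    and h0: "\<And>t. h t 0 = 0"
  obtains Y where "Y 0 = y0" "\<And>t. (Y has_vector_derivative h t (Y t)) (at t)"
proof -
  define b where "b = max \<beta> 1"
  have b: "b > 0" by (simp add: b_def)
  have lip_b: "norm (h t x - h t y) \<le> b * norm (x - y)" for t x y
    using lip_h[of t x y] mult_right_mono[of \<beta> b "norm (x - y)"] by (simp add: b_def)
  define E where "E t = exp (2 * b * \<bar>t\<bar>)" for t :: real
  have E: "E t \<ge> 1" "E t > 0" for t
    using b(1) by (auto simp: E_def)
  \<comment> \<open>A bounded function \<open>V\<close> encodes the candidate \<open>E t\<close>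
    times \<open>V t\<close>, so the plain sup norm of \<open>V\<close> is the weighted norm of the
    candidate.\<close>
  define k where "k V t = h t (E t *\<^sub>R apply_bcontfun V t)" for V t
  have cont: "continuous_on UNIV (k V)" for V
    unfolding k_def E_def by (intro cont_h continuous_intros) auto
  have lip: "norm (k V t - k W t) \<le> dist V W * b * E t" for V W t
  proof -
    have "norm (k V t - k W t) \<le> b * norm (E t *\<^sub>R apply_bcontfun V t - E t *\<^sub>R apply_bcontfun W t)"
      unfolding k_def by (rule lip_b)
    also have "\<dots> = b * (E t * dist (apply_bcontfun V t) (apply_bcontfun W t))"
      using E[of t] by (simp add: scaleR_diff_right[symmetric] dist_norm)
    also have "\<dots> \<le> b * (E t * dist V W)"
      using E[of t] b by (intro mult_left_mono dist_bounded) auto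
    finally show ?thesis by (simp add: mult_ac)
  qed
  have "\<exists>K. K 0 = 0 \<and> (\<forall>t. (K has_vector_derivative k V t) (at t))" for V
    using antiderivative_on_reals[OF cont] by metis
  then obtain K where K0: "\<And>V. K V 0 = 0"
    and K: "\<And>V t. (K V has_vector_derivative k V t) (at t)" by metis
  have K_lip: "norm (K V t - K W t) \<le> dist V W / 2 * E t" for V W t
    unfolding E_def
    by (rule norm_le_of_exponential_derivative_bound[where k = "\<lambda>t. k V t - k W t"])
       (auto intro!: derivative_eq_intros K lip[unfolded E_def] simp: K0)
  \<comment> \<open>Comparison with \<open>V = 0\<close>, where \<open>k\<close> vanishes because
    \<open>h t 0 = 0\<close>; this keeps the Picard image bounded after division by the
    weight.\<close>
  have K_bound: "norm (K V t) \<le> dist V 0 / 2 * E t" for V t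
    unfolding E_def
    using lip[of V _ 0] by (intro norm_le_of_exponential_derivative_bound[where k = "k V"] K K0)
       (auto simp: k_def E_def h0)
  define \<Psi> where "\<Psi> V = Bcontfun (\<lambda>t. inverse (E t) *\<^sub>R (y0 + K V t))" for V
  have K_cont: "continuous_on UNIV (K V)" for V
    by (meson K continuous_at_imp_continuous_on has_vector_derivative_continuous)
  have "(\<lambda>t. inverse (E t) *\<^sub>R (y0 + K V t)) \<in> bcontfun" for V
  proof (rule bcontfun_normI)
    show "continuous_on UNIV (\<lambda>t. inverse (E t) *\<^sub>R (y0 + K V t))"
      unfolding E_def by (intro continuous_intros K_cont) auto
    fix t
    have "norm (y0 + K V t) \<le> norm y0 * E t + dist V 0 / 2 * E t"
      using E[of t] by (intro norm_triangle_le add_mono K_bound) (simp add: mult_le_cancel_left1)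
    also have "\<dots> = (norm y0 + dist V 0 / 2) * E t" by (simp add: algebra_simps)
    finally show "norm (inverse (E t) *\<^sub>R (y0 + K V t)) \<le> norm y0 + dist V 0 / 2"
      using E[of t] by (simp add: pos_divide_le_eq inverse_eq_divide del: scaleR_add_right)
  qed
  then have \<Psi>: "apply_bcontfun (\<Psi> V) t = inverse (E t) *\<^sub>R (y0 + K V t)" for V t
    by (simp add: \<Psi>_def Bcontfun_inverse)
  have "dist (\<Psi> V) (\<Psi> W) \<le> 1 / 2 * dist V W" for V W
  proof (rule dist_bound)
    fix t
    have "apply_bcontfun (\<Psi> V) t - apply_bcontfun (\<Psi> W) t = inverse (E t) *\<^sub>R (K V t - K W t)"
      by (simp add: \<Psi> algebra_simps)
    then show "dist (apply_bcontfun (\<Psi> V) t) (apply_bcontfun (\<Psi> W) t) \<le> 1 / 2 * dist V W"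
      using K_lip[of V t W] E[of t] by (simp add: dist_norm divide_simps mult_ac)
  qed
  then obtain V where V: "\<Psi> V = V"
    using banach_fix_type[of "1/2" \<Psi>] by auto
  have EV: "E t *\<^sub>R apply_bcontfun V t = y0 + K V t" for t
    using \<Psi>[of V t] E[of t] V by simp
  show thesis
  proof
    show "y0 + K V 0 = y0" by (simp add: K0)
    have "((\<lambda>t. y0 + K V t) has_vector_derivative k V t) (at t)" for t
      by (auto intro!: derivative_eq_intros K)
    then show "((\<lambda>t. y0 + K V t) has_vector_derivative h t (y0 + K V t)) (at t)" for t
      by (simp add: k_def EV)
  qed
qed

text \<open>The zero set of \<open>y\<close> is clopen: on the ball of radius
  \<open>c = 1 / (2 * b)\<close> around a zero, the mean value inequality bounds the maximum of
  \<open>norm (y s)\<close> by half of itself. A growth bound on \<open>y'\<close> is assumed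
  instead of an equation, so that the commutator equation for the inverse Cauchy operator is covered
  too.\<close>

lemma linear_ode_unique:
  fixes y :: "real \<Rightarrow> 'e::real_normed_vector"
  assumes y: "\<And>t. (y has_vector_derivative y' t) (at t)"
    and y': "\<And>t. norm (y' t) \<le> \<beta> * norm (y t)" and "y 0 = 0"
  shows "y t = 0"
proof -
  have cont: "continuous_on S y" for S
    by (meson y continuous_at_imp_continuous_on has_vector_derivative_continuous)
  define b where "b = max \<beta> 1"
  define c where "c = 1 / (2 * b)"
  have b: "b > 0" "norm (y' t) \<le> b * norm (y t)" for t
    using y'[of t] mult_right_mono[of \<beta> b "norm (y t)"] by (auto simp: b_def)
  have c: "c > 0" using b by (simp add: c_def)
  have local: "y s = 0" if "y t0 = 0" "s \<in> cball t0 c" for t0 s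
  proof -
    have "cball t0 c \<noteq> {}" using c by auto
    then obtain m where m: "m \<in> cball t0 c" "\<And>s. s \<in> cball t0 c \<Longrightarrow> norm (y s) \<le> norm (y m)"
      using continuous_attains_sup[OF compact_cball _ continuous_on_norm[OF cont]] by blast
    have "norm (y m - y t0) \<le> b * norm (y m) * norm (m - t0)"
    proof (rule differentiable_bound[where f' = "\<lambda>s x. x *\<^sub>R y' s"])
      show "(y has_derivative (\<lambda>x. x *\<^sub>R y' s)) (at s within cball t0 c)" for s
        using y[of s] by (simp add: has_vector_derivative_def has_derivative_at_withinI)
      show "onorm (\<lambda>x. x *\<^sub>R y' s) \<le> b * norm (y m)" if "s \<in> cball t0 c" for s
      proof (rule onorm_bound)
        show "norm (x *\<^sub>R y' s) \<le> b * norm (y m) * norm x" for x :: real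
          using b(2)[of s] mult_left_mono[OF m(2)[OF that] less_imp_le[OF b(1)]]
          by (simp add: mult.commute[of "\<bar>x\<bar>"] mult_right_mono)
      qed (use b in auto)
    qed (use m c in auto)
    also have "\<dots> \<le> b * norm (y m) * c"
      using m(1) b by (intro mult_left_mono) (auto simp: dist_norm norm_minus_commute)
    also have "\<dots> = norm (y m) / 2"
      using b by (simp add: c_def)
    finally have "norm (y m) = 0" using that by simp
    then show ?thesis using m(2)[OF that(2)] by simp
  qed
  have "closed {t. y t = 0}"
    using closed_Collect_eq[OF cont continuous_on_const] .
  moreover have "open {t. y t = 0}"
    unfolding open_contains_cball using local c by (intro ballI exI[of _ c]) auto
  ultimately have "{t. y t = 0} = UNIV"
    using clopen[of "{t. y t = 0}"] \<open>y 0 = 0\<close> by auto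
  then show ?thesis by auto
qed

lemma constant_of_zero_vector_derivative:
  fixes y :: "real \<Rightarrow> 'e::real_normed_vector"
  assumes "\<And>t. (y has_vector_derivative 0) (at t)"
  shows "y t = y s"
  using has_vector_derivative_zero_constant[of UNIV y] assms by (metis UNIV_I convex_UNIV)

section \<open>The Cauchy operator and its inverse\<close>

locale bounded_linear_ode =
  fixes A :: "real \<Rightarrow> 'a::banach \<Rightarrow>\<^sub>L 'a" and \<alpha> :: real
  assumes continuous_A: "continuous_on UNIV A"
    and bounded_A: "\<And>t. norm (A t) \<le> \<alpha>"
begin

lemma solution_unique:
  assumes "\<And>t. (y has_vector_derivative blinfun_apply (A t) (y t)) (at t)"
    "\<And>t. (z has_vector_derivative blinfun_apply (A t) (z t)) (at t)" "y 0 = z 0"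
  shows "y t = z t"
proof -
  have "y t - z t = 0"
  proof (rule linear_ode_unique)
    show "((\<lambda>t. y t - z t) has_vector_derivative A t (y t - z t)) (at t)" for t
      using has_vector_derivative_diff[OF assms(1,2)] by (simp add: blinfun.diff_right)
    show "norm (A t (y t - z t)) \<le> \<alpha> * norm (y t - z t)" for t
      using bounded_A by (intro order.trans[OF norm_blinfun] mult_right_mono) auto
  qed (simp add: assms)
  then show ?thesis by simp
qed

text \<open>The equation is solved in the operator space, so \<open>U\<close> is differentiable in
  operator norm, which is more than the vectorwise property in the definition of
  \<open>cauchy_op\<close>. Uniqueness for each initial vector then identifies \<open>U\<close> with
  \<open>cauchy_op A\<close>.\<close>

lemma cauchy_op_properties:
  shows cauchy_op_0: "cauchy_op A 0 = id_blinfun"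
    and cauchy_op_derivative: "(cauchy_op A has_vector_derivative (A t o\<^sub>L cauchy_op A t)) (at t)"
proof -
  obtain U where U: "U 0 = id_blinfun"
    "\<And>t. (U has_vector_derivative (A t o\<^sub>L U t)) (at t)"
  proof (rule lipschitz_ode_exists[of "\<lambda>t V. A t o\<^sub>L V" \<alpha> id_blinfun])
    show "norm ((A t o\<^sub>L V) - (A t o\<^sub>L W)) \<le> \<alpha> * norm (V - W)" for t V and W :: "'a \<Rightarrow>\<^sub>L 'a"
      unfolding bounded_bilinear.diff_right[OF bounded_bilinear_blinfun_compose, symmetric]
      by (intro order.trans[OF norm_blinfun_compose] mult_right_mono bounded_A norm_ge_zero)
    show "continuous_on UNIV (\<lambda>t. A t o\<^sub>L V t)"
      if "continuous_on UNIV V" for V :: "real \<Rightarrow> 'a \<Rightarrow>\<^sub>L 'a"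
      by (rule bounded_bilinear.continuous_on[OF bounded_bilinear_blinfun_compose continuous_A that])
  qed (simp, rule that)
  have "((\<lambda>t. blinfun_apply (U t) x) has_vector_derivative A t (U t x)) (at t)" for t x
    using blinfun.has_vector_derivative[OF U(2) has_vector_derivative_const, of x t] by simp
  then have sol: "solves_on_reals (\<lambda>t. blinfun_apply (U t) x) (\<lambda>t. blinfun_apply (A t))" for x
    by (simp add: solves_on_reals_def)
  have "cauchy_op A = U"
    unfolding cauchy_op_def
  proof (rule the_equality)
    fix V :: "real \<Rightarrow> 'a \<Rightarrow>\<^sub>L 'a"
    assume V: "V 0 = id_blinfun \<and>
      (\<forall>x. solves_on_reals (\<lambda>t. blinfun_apply (V t) x) (\<lambda>t. blinfun_apply (A t)))"
    have "V t x = U t x" for t x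
      by (rule solution_unique[of "\<lambda>t. V t x" "\<lambda>t. U t x"])
        (use V sol U(1) in \<open>auto simp: solves_on_reals_def\<close>)
    then show "V = U" by (intro ext blinfun_eqI)
  qed (use U sol in simp)
  then show "cauchy_op A 0 = id_blinfun" "(cauchy_op A has_vector_derivative (A t o\<^sub>L cauchy_op A t)) (at t)"
    using U by auto
qed

text \<open>The inverse is built as the solution of \<open>W' = - W A\<close>. In infinite
  dimensions a left inverse need not be a right inverse, so both products are treated:
  \<open>W U\<close> has derivative 0, and \<open>U W - I\<close> solves a linear equation with
  initial value 0.\<close>

lemma cauchy_op_inv_properties:
  shows cauchy_op_inv_right: "cauchy_op A t o\<^sub>L cauchy_op_inv A t = id_blinfun"
    and cauchy_op_inv_left: "cauchy_op_inv A t o\<^sub>L cauchy_op A t = id_blinfun"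
    and continuous_cauchy_op_inv: "continuous_on UNIV (cauchy_op_inv A)"
proof -
  let ?U = "cauchy_op A"
  note comp = bounded_bilinear_blinfun_compose
  obtain W where W: "W 0 = id_blinfun"
    "\<And>t. (W has_vector_derivative - (W t o\<^sub>L A t)) (at t)"
  proof (rule lipschitz_ode_exists[of "\<lambda>t V. - (V o\<^sub>L A t)" \<alpha> id_blinfun])
    show "norm (- (V o\<^sub>L A t) - - (W o\<^sub>L A t)) \<le> \<alpha> * norm (V - W)" for t V and W :: "'a \<Rightarrow>\<^sub>L 'a"
    proof -
      have "- (V o\<^sub>L A t) - - (W o\<^sub>L A t) = (W - V) o\<^sub>L A t"
        by (simp add: bounded_bilinear.diff_left[OF comp])
      also have "norm \<dots> \<le> norm (W - V) * \<alpha>"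
        by (intro order.trans[OF norm_blinfun_compose] mult_left_mono bounded_A norm_ge_zero)
      finally show ?thesis by (simp add: mult.commute norm_minus_commute)
    qed
    show "continuous_on UNIV (\<lambda>t. - (V t o\<^sub>L A t))"
      if "continuous_on UNIV V" for V :: "real \<Rightarrow> 'a \<Rightarrow>\<^sub>L 'a"
      by (rule continuous_on_minus[OF bounded_bilinear.continuous_on[OF comp that continuous_A]])
  qed (simp, rule that)
  have "((\<lambda>t. W t o\<^sub>L ?U t) has_vector_derivative 0) (at t)" for t
    using bounded_bilinear.has_vector_derivative[OF comp W(2) cauchy_op_derivative, of t]
    by (auto elim!: has_vector_derivative_eq_rhs intro!: blinfun_eqI simp: blinfun.bilinear_simps)
  from constant_of_zero_vector_derivative[OF this, of _ 0]
  have WU: "W t o\<^sub>L ?U t = id_blinfun" for t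
    by (simp add: W cauchy_op_0 id_blinfun.rep_eq blinfun_eqI)
  \<comment> \<open>The product satisfies \<open>X' = A X - X A\<close>, and so does its difference
    from the identity, which commutes with \<open>A t\<close>.\<close>
  have "(?U t o\<^sub>L W t) - id_blinfun = 0" for t
  proof (rule linear_ode_unique[where \<beta> = "2 * \<alpha>"])
    fix t
    let ?D = "(?U t o\<^sub>L W t) - id_blinfun"
    show "((\<lambda>t. (?U t o\<^sub>L W t) - id_blinfun) has_vector_derivative (A t o\<^sub>L ?D) - (?D o\<^sub>L A t)) (at t)"
      using bounded_bilinear.has_vector_derivative[OF comp cauchy_op_derivative W(2), of t]
      by (auto intro!: derivative_eq_intros blinfun_eqI simp: blinfun.bilinear_simps)
    have "norm (A t o\<^sub>L ?D) \<le> \<alpha> * norm ?D" "norm (?D o\<^sub>L A t) \<le> \<alpha> * norm ?D"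
      using bounded_A[of t]
      by (auto intro!: order.trans[OF norm_blinfun_compose] mult_right_mono simp: mult.commute[of "norm ?D"])
    then show "norm ((A t o\<^sub>L ?D) - (?D o\<^sub>L A t)) \<le> 2 * \<alpha> * norm ?D"
      using norm_triangle_ineq4[of "A t o\<^sub>L ?D" "?D o\<^sub>L A t"] by linarith
  qed (simp add: W cauchy_op_0 blinfun_eqI)
  then have UW: "?U t o\<^sub>L W t = id_blinfun" for t by simp
  have "inv (blinfun_apply (?U t)) = blinfun_apply (W t)" for t
    using UW[of t] WU[of t]
    by (intro inv_equality) (metis blinfun_apply_blinfun_compose blinfun_apply_id_blinfun)+
  then have "cauchy_op_inv A t = W t" for t
    by (simp add: cauchy_op_inv_def blinfun_apply_inverse)
  then have W_eq: "cauchy_op_inv A = W" ..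
  show "?U t o\<^sub>L cauchy_op_inv A t = id_blinfun" "cauchy_op_inv A t o\<^sub>L ?U t = id_blinfun"
    by (simp_all add: W_eq UW WU)
  show "continuous_on UNIV (cauchy_op_inv A)"
    unfolding W_eq by (meson W(2) continuous_at_imp_continuous_on has_vector_derivative_continuous)
qed

lemma cauchy_op_solution:
  assumes "\<And>t. (z has_vector_derivative blinfun_apply (A t) (z t)) (at t)"
  shows "z t = cauchy_op A t (z 0)"
proof (rule solution_unique[OF assms])
  show "((\<lambda>t. cauchy_op A t (z 0)) has_vector_derivative A t (cauchy_op A t (z 0))) (at t)" for t
    using blinfun.has_vector_derivative[OF cauchy_op_derivative has_vector_derivative_const, of "z 0" t]
    by simp
qed (simp add: cauchy_op_0)

end

subsection \<open>Green function of a trichotomic equation\<close>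

lemma has_integral_exp_minus_abs:
  fixes a t :: real
  assumes a: "a > 0"
  shows "((\<lambda>\<tau>. exp (- a * \<bar>t - \<tau>\<bar>)) has_integral 2 / a) UNIV"
proof -
  have right: "((\<lambda>\<tau>. exp (- a * \<bar>s - \<tau>\<bar>)) has_integral 1 / a) {s..}" for s :: real
  proof -
    have "((\<lambda>\<tau>. exp (a * s) * exp (- a * \<tau>)) has_integral exp (a * s) * (exp (- a * s) / a)) {s..}"
      by (intro has_integral_mult_right has_integral_exp_minus_to_infinity a)
    also have "exp (a * s) * (exp (- a * s) / a) = 1 / a"
      by (simp add: exp_minus)
    also have "((\<lambda>\<tau>. exp (a * s) * exp (- a * \<tau>)) has_integral 1 / a) {s..} \<longleftrightarrow> ?thesis"
      by (rule has_integral_cong) (auto simp: exp_add[symmetric] algebra_simps)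
    finally show ?thesis .
  qed
  have "(\<lambda>\<tau>. exp (- a * \<bar>- t - \<tau>\<bar>)) absolutely_integrable_on {-t..} \<and>
      integral {-t..} (\<lambda>\<tau>. exp (- a * \<bar>- t - \<tau>\<bar>)) = 1 / a"
    using right[of "-t"]
    by (auto intro!: nonnegative_absolutely_integrable_1 has_integral_integrable)
  also have "?this \<longleftrightarrow> (\<lambda>\<tau>. exp (- a * \<bar>- t - (- \<tau>)\<bar>)) absolutely_integrable_on {..t} \<and>
      integral {..t} (\<lambda>\<tau>. exp (- a * \<bar>- t - (- \<tau>)\<bar>)) = 1 / a"
    by (rule has_absolute_integral_reflect_real[symmetric]) auto
  finally have "((\<lambda>\<tau>. exp (- a * \<bar>- t - (- \<tau>)\<bar>)) has_integral 1 / a) {..t}"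
    by (auto simp: has_integral_iff intro: set_lebesgue_integral_eq_integral)
  then have left: "((\<lambda>\<tau>. exp (- a * \<bar>t - \<tau>\<bar>)) has_integral 1 / a) {..t}"
    by (simp add: abs_minus_commute add.commute)
  have "((\<lambda>\<tau>. exp (- a * \<bar>t - \<tau>\<bar>)) has_integral (1 / a + 1 / a)) ({..t} \<union> {t..})"
    by (rule has_integral_Un[OF left right]) (auto intro: negligible_subset[OF negligible_sing[of t]])
  moreover have "{..t} \<union> {t..} = UNIV" by auto
  ultimately show ?thesis by (simp add: field_simps)
qed

lemma norm_has_integral_le:
  fixes f :: "'n::euclidean_space \<Rightarrow> 'b::banach"
  assumes "(f has_integral i) S" "(g has_integral j) S" "\<And>x. x \<in> S \<Longrightarrow> norm (f x) \<le> g x"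
  shows "norm i \<le> j"
  using integral_norm_bound_integral[of f S g] assms by (auto simp: has_integral_iff)

lemma zero_of_exponential_bound:
  fixes x :: "'e::real_normed_vector"
  assumes "\<And>\<tau>. \<tau> \<ge> 0 \<Longrightarrow> norm x \<le> C * exp (- \<nu> * \<tau>)" and "\<nu> > 0"
  shows "x = 0"
proof (rule ccontr)
  assume "x \<noteq> 0"
  then have x: "norm x > 0" by simp
  have C: "C > 0" using assms(1)[of 0] x by (simp del: zero_less_norm_iff)
  \<comment> \<open>With this \<open>\<tau>\<close> the product
    \<open>norm x * (1 + \<nu> * \<tau>)\<close> equals \<open>norm x + C\<close>, which exceeds the
    bound \<open>C\<close> obtained below.\<close>
  define \<tau> where "\<tau> = C / (\<nu> * norm x)"
  have "\<tau> \<ge> 0" using C x \<open>\<nu> > 0\<close> by (simp add: \<tau>_def)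
  have "norm x * (1 + \<nu> * \<tau>) \<le> norm x * exp (\<nu> * \<tau>)"
    using x by (intro mult_left_mono exp_ge_add_one_self) auto
  also have "\<dots> \<le> C"
    using assms(1)[OF \<open>\<tau> \<ge> 0\<close>] by (simp add: exp_minus divide_simps)
  finally show False using x \<open>\<nu> > 0\<close> by (simp add: \<tau>_def field_simps)
qed

section \<open>Kernel bounds and the Green operator of a trichotomy\<close>

locale trichotomy = bounded_linear_ode A \<alpha> for A :: "real \<Rightarrow> 'a::banach \<Rightarrow>\<^sub>L 'a" and \<alpha> +
  fixes P Q :: "'a \<Rightarrow>\<^sub>L 'a" and N \<nu> :: real
  assumes trichotomy: "exp_trichotomy A P Q N \<nu>"
begin

lemma N_ge_1: "N \<ge> 1" and \<nu>_pos: "\<nu> > 0"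
  using trichotomy by (simp_all add: exp_trichotomy_def)

lemma norm_transported:
  shows "0 \<le> \<tau> \<Longrightarrow> \<tau> \<le> t \<Longrightarrow> norm (transported A P t \<tau>) \<le> N * exp (- \<nu> * \<bar>t - \<tau>\<bar>)"
    and "0 \<le> \<tau> \<Longrightarrow> t \<le> \<tau> \<Longrightarrow> norm (transported A (id_blinfun - P) t \<tau>) \<le> N * exp (- \<nu> * \<bar>t - \<tau>\<bar>)"
    and "\<tau> \<le> 0 \<Longrightarrow> t \<le> \<tau> \<Longrightarrow> norm (transported A Q t \<tau>) \<le> N * exp (- \<nu> * \<bar>t - \<tau>\<bar>)"
    and "\<tau> \<le> 0 \<Longrightarrow> \<tau> \<le> t \<Longrightarrow> norm (transported A (id_blinfun - Q) t \<tau>) \<le> N * exp (- \<nu> * \<bar>t - \<tau>\<bar>)"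
  using trichotomy by (simp_all add: exp_trichotomy_def abs_of_nonneg abs_of_nonpos)

lemma norm_green: "norm (green A P Q t \<tau>) \<le> N * exp (- \<nu> * \<bar>t - \<tau>\<bar>)"
  using norm_transported[of \<tau> t] unfolding green_def
  by (cases "0 \<le> \<tau>"; cases "\<tau> < t"; simp)

lemma norm_green_apply: "norm (green A P Q t \<tau> x) \<le> N * exp (- \<nu> * \<bar>t - \<tau>\<bar>) * norm x"
  by (intro order.trans[OF norm_blinfun] mult_right_mono norm_green norm_ge_zero)

lemma cauchy_op_inv_0: "cauchy_op_inv A 0 = id_blinfun"
  using cauchy_op_inv_left[of 0] by (metis blinfun_apply_blinfun_compose blinfun_apply_id_blinfun
    blinfun_eqI cauchy_op_0)

lemma cauchy_op_inv_apply [simp]: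
  "cauchy_op A t (cauchy_op_inv A t x) = x" "cauchy_op_inv A t (cauchy_op A t x) = x"
  using cauchy_op_inv_right[of t] cauchy_op_inv_left[of t]
  by (metis blinfun_apply_blinfun_compose blinfun_apply_id_blinfun)+

text \<open>\<open>G(t, \<tau>)\<close> and \<open>U(t) G(0, \<tau>)\<close> differ only for
  \<open>\<tau>\<close> between 0 and \<open>t\<close>, where the difference is
  \<open>U(t) U^{-1}(\<tau>)\<close> up to sign. Integrability and the dependence on
  \<open>t\<close> are thereby reduced to the single kernel at time 0.\<close>

lemma green_via_zero:
  "green A P Q t \<tau> x = cauchy_op A t (green A P Q 0 \<tau> x +
     (if 0 \<le> \<tau> \<and> \<tau> < t then cauchy_op_inv A \<tau> x
      else if t \<le> \<tau> \<and> \<tau> < 0 then - cauchy_op_inv A \<tau> x else 0))"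
  by (cases "0 \<le> \<tau>"; cases "\<tau> < t")
    (simp_all add: green_def transported_def cauchy_op_0 blinfun.bilinear_simps)

lemma green_zero_apply:
  "green A P Q 0 \<tau> x = (if 0 \<le> \<tau> then P (cauchy_op_inv A \<tau> x) - cauchy_op_inv A \<tau> x
     else cauchy_op_inv A \<tau> x - Q (cauchy_op_inv A \<tau> x))"
  by (simp add: green_def transported_def cauchy_op_0 blinfun.bilinear_simps)

definition green_op :: "(real \<Rightarrow> 'a) \<Rightarrow> real \<Rightarrow> 'a" where
  "green_op g t = integral UNIV (\<lambda>\<tau>. green A P Q t \<tau> (g \<tau>))"

lemma green_integrable_zero:
  assumes g: "continuous_on UNIV g" "\<And>t. norm (g t) \<le> M"
  shows "(\<lambda>\<tau>. green A P Q 0 \<tau> (g \<tau>)) integrable_on UNIV"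
proof (rule integrable_on_all_intervals_UNIV)
  show "norm (green A P Q 0 \<tau> (g \<tau>)) \<le> exp (- \<nu> * \<bar>0 - \<tau>\<bar>) * (N * M)" for \<tau>
    using order.trans[OF norm_green_apply mult_left_mono[OF g(2)[of \<tau>]], of 0 \<tau>] N_ge_1
    by (simp add: mult_ac)
  show "(\<lambda>\<tau>. exp (- \<nu> * \<bar>0 - \<tau>\<bar>) * (N * M)) integrable_on UNIV"
    by (intro integrable_on_mult_left has_integral_integrable[OF has_integral_exp_minus_abs] \<nu>_pos)
  define k where "k \<tau> = cauchy_op_inv A \<tau> (g \<tau>)" for \<tau>
  have k: "continuous_on T k" for T
    unfolding k_def using g(1) continuous_cauchy_op_inv
    by (auto intro!: blinfun.continuous_on intro: continuous_on_subset)
  fix a b :: real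
  \<comment> \<open>The kernel may jump at 0 but gives a continuous integrand on either half-line.
    Both restrictions include 0, so their sum may be wrong at that one point.\<close>
  have "(\<lambda>\<tau>. if \<tau> \<in> {0..} then P (k \<tau>) - k \<tau> else 0) integrable_on {a..b}"
    "(\<lambda>\<tau>. if \<tau> \<in> {..0} then k \<tau> - Q (k \<tau>) else 0) integrable_on {a..b}"
    unfolding integrable_restrict_Int
    by (auto simp: Int_atLeastAtMostR1 Int_atLeastAtMostR2 Int_atLeastAtMostL1 Int_atLeastAtMostL2
        intro!: integrable_continuous_interval continuous_intros k)
  from integrable_add[OF this] have "(\<lambda>\<tau>. green A P Q 0 \<tau> (g \<tau>)) integrable_on {a..b}"
    by (rule integrable_spike_finite[of "{0}", rotated 2]) (auto simp: green_zero_apply k_def)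
  then show "(\<lambda>\<tau>. green A P Q 0 \<tau> (g \<tau>)) integrable_on cbox a b" by simp
qed

text \<open>Variation of constants: the Green integral is \<open>U(t) H(t)\<close> with
  \<open>H' = U^{-1} g\<close>, where \<open>H\<close> starts from the Green integral at time 0.
  Convergence for every \<open>t\<close> and differentiability in \<open>t\<close> are both read off
  from this form.\<close>

lemma green_op_formula:
  assumes g: "continuous_on UNIV g" "\<And>t. norm (g t) \<le> M"
  obtains H where "\<And>t. (H has_vector_derivative cauchy_op_inv A t (g t)) (at t)"
    "\<And>t. ((\<lambda>\<tau>. green A P Q t \<tau> (g \<tau>)) has_integral cauchy_op A t (H t)) UNIV"
proof -
  define k where "k \<tau> = cauchy_op_inv A \<tau> (g \<tau>)" for \<tau>
  have "continuous_on UNIV k"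
    unfolding k_def by (intro blinfun.continuous_on g continuous_cauchy_op_inv)
  then obtain K where K: "K 0 = 0" "\<And>t. (K has_vector_derivative k t) (at t)"
    using antiderivative_on_reals by blast
  have FTC: "(k has_integral K t - K s) {s..t}" if "s \<le> t" for s t
    using that K(2) by (intro fundamental_theorem_of_calculus) (auto intro: has_vector_derivative_at_within)
  define c where "c = integral UNIV (\<lambda>\<tau>. green A P Q 0 \<tau> (g \<tau>))"
  have c: "((\<lambda>\<tau>. green A P Q 0 \<tau> (g \<tau>)) has_integral c) UNIV"
    unfolding c_def using green_integrable_zero[OF g] by (rule integrable_integral)
  have corr: "((\<lambda>\<tau>. if 0 \<le> \<tau> \<and> \<tau> < t then k \<tau> else if t \<le> \<tau> \<and> \<tau> < 0 then - k \<tau> else 0)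
      has_integral K t) UNIV" (is "(?\<chi> has_integral _) _") for t
  proof (cases "t \<ge> 0")
    case True
    have "((\<lambda>\<tau>. if \<tau> \<in> {0..t} then k \<tau> else 0) has_integral K t) UNIV"
      unfolding has_integral_restrict_UNIV using FTC[OF True] K(1) by simp
    then show ?thesis
      by (rule has_integral_spike_finite[of "{t}", rotated 2]) (use True in auto)
  next
    case False
    have "((\<lambda>\<tau>. if \<tau> \<in> {t..0} then - k \<tau> else 0) has_integral K t) UNIV"
      unfolding has_integral_restrict_UNIV using has_integral_neg[OF FTC[of t 0]] False K(1) by simp
    then show ?thesis
      by (rule has_integral_spike_finite[of "{0}", rotated 2]) (use False in auto)
  qed
  show thesis
  proof (rule that[of "\<lambda>t. c + K t"])
    show "((\<lambda>t. c + K t) has_vector_derivative cauchy_op_inv A t (g t)) (at t)" for t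
      using K(2)[of t] by (auto intro!: derivative_eq_intros simp: k_def)
    show "((\<lambda>\<tau>. green A P Q t \<tau> (g \<tau>)) has_integral cauchy_op A t (c + K t)) UNIV" for t
      using has_integral_linear[OF has_integral_add[OF c corr[of t]]
        blinfun.bounded_linear_right[of "cauchy_op A t"]]
      unfolding o_def k_def green_via_zero[of t] .
  qed
qed

lemma green_op_has_integral:
  assumes "continuous_on UNIV g" "\<And>t. norm (g t) \<le> M"
  shows "((\<lambda>\<tau>. green A P Q t \<tau> (g \<tau>)) has_integral green_op g t) UNIV"
proof -
  obtain H where "((\<lambda>\<tau>. green A P Q t \<tau> (g \<tau>)) has_integral cauchy_op A t (H t)) UNIV"
    using green_op_formula[OF assms] by blast
  then show ?thesis
    unfolding green_op_def by (intro integrable_integral has_integral_integrable)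
qed

lemma green_op_derivative:
  assumes "continuous_on UNIV g" "\<And>t. norm (g t) \<le> M"
  shows "(green_op g has_vector_derivative A t (green_op g t) + g t) (at t)"
proof -
  obtain H where H: "\<And>t. (H has_vector_derivative cauchy_op_inv A t (g t)) (at t)"
    "\<And>t. ((\<lambda>\<tau>. green A P Q t \<tau> (g \<tau>)) has_integral cauchy_op A t (H t)) UNIV"
    using green_op_formula[OF assms] by blast
  have eq: "green_op g = (\<lambda>t. cauchy_op A t (H t))"
    unfolding green_op_def using H(2) by (auto intro: integral_unique)
  show ?thesis
    using blinfun.has_vector_derivative[OF cauchy_op_derivative H(1), of t]
    by (simp add: eq add.commute)
qed

lemma green_op_continuous:
  assumes "continuous_on UNIV g" "\<And>t. norm (g t) \<le> M"
  shows "continuous_on UNIV (green_op g)"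
  using has_vector_derivative_continuous[OF green_op_derivative[OF assms]]
  by (intro continuous_at_imp_continuous_on) blast

lemma norm_green_op_le:
  assumes "continuous_on UNIV g" "\<And>t. norm (g t) \<le> M"
  shows "norm (green_op g t) \<le> 2 * N / \<nu> * M"
proof -
  have "((\<lambda>\<tau>. N * M * exp (- \<nu> * \<bar>t - \<tau>\<bar>)) has_integral N * M * (2 / \<nu>)) UNIV"
    by (intro has_integral_mult_right has_integral_exp_minus_abs \<nu>_pos)
  from norm_has_integral_le[OF green_op_has_integral[OF assms] this]
  have "norm (green_op g t) \<le> N * M * (2 / \<nu>)"
    using order.trans[OF norm_green_apply mult_left_mono[OF assms(2)]] N_ge_1
    by (simp add: mult_ac)
  then show ?thesis by (simp add: mult_ac)
qed

lemma green_op_diff: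
  assumes "continuous_on UNIV g" "\<And>t. norm (g t) \<le> M"
    "continuous_on UNIV g'" "\<And>t. norm (g' t) \<le> M'"
  shows "green_op g t - green_op g' t = green_op (\<lambda>\<tau>. g \<tau> - g' \<tau>) t"
  using integral_unique[OF has_integral_diff[OF green_op_has_integral[OF assms(1,2)]
      green_op_has_integral[OF assms(3,4)]], of t]
  by (simp add: green_op_def blinfun.diff_right)

text \<open>The far part of the integral is controlled by
  \<open>exp (- \<nu> s) \<le> exp (- \<nu> T / 2) exp (- \<nu> s / 2)\<close> for \<open>s \<ge> T\<close>.\<close>
lemma norm_green_op_local:
  assumes g: "continuous_on UNIV g" "\<And>t. norm (g t) \<le> M"
    and near: "\<And>\<tau>. \<bar>\<tau> - t\<bar> \<le> T \<Longrightarrow> norm (g \<tau>) \<le> e" and "e \<ge> 0"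
  shows "norm (green_op g t) \<le> 2 * N / \<nu> * e + 4 * N / \<nu> * M * exp (- \<nu> / 2 * T)"
proof -
  have M: "M \<ge> 0" using g(2)[of 0] norm_ge_zero order_trans by blast
  have N: "N \<ge> 0" using N_ge_1 by simp
  let ?E = "\<lambda>a \<tau>. exp (- a * \<bar>t - \<tau>\<bar>)"
  define c where "c = exp (- (\<nu> / 2) * T)"
  have int: "((\<lambda>\<tau>. N * e * ?E \<nu> \<tau> + N * M * c * ?E (\<nu> / 2) \<tau>) has_integral
      N * e * (2 / \<nu>) + N * M * c * (2 / (\<nu> / 2))) UNIV"
    using \<nu>_pos by (intro has_integral_add has_integral_mult_right has_integral_exp_minus_abs) auto
  have "norm (green A P Q t \<tau> (g \<tau>)) \<le> N * e * ?E \<nu> \<tau> + N * M * c * ?E (\<nu> / 2) \<tau>" for \<tau>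
  proof (cases "\<bar>\<tau> - t\<bar> \<le> T")
    case True
    have "norm (green A P Q t \<tau> (g \<tau>)) \<le> N * ?E \<nu> \<tau> * e"
      using N near[OF True] by (intro order.trans[OF norm_green_apply] mult_left_mono) auto
    also have "\<dots> \<le> N * e * ?E \<nu> \<tau> + N * M * c * ?E (\<nu> / 2) \<tau>"
      using M N by (simp add: c_def)
    finally show ?thesis .
  next
    case False
    have "?E \<nu> \<tau> \<le> c * ?E (\<nu> / 2) \<tau>"
      using False \<nu>_pos by (simp add: c_def exp_add[symmetric] field_simps abs_minus_commute)
    then have "N * ?E \<nu> \<tau> * M \<le> N * (c * ?E (\<nu> / 2) \<tau>) * M"
      using M N by (intro mult_right_mono mult_left_mono)
    with order.trans[OF norm_green_apply mult_left_mono[OF g(2)]]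
    have "norm (green A P Q t \<tau> (g \<tau>)) \<le> N * (c * ?E (\<nu> / 2) \<tau>) * M"
      using N by (meson exp_ge_zero mult_nonneg_nonneg order_trans)
    also have "\<dots> \<le> N * e * ?E \<nu> \<tau> + N * M * c * ?E (\<nu> / 2) \<tau>"
      using N \<open>e \<ge> 0\<close> by (simp add: mult_ac)
    finally show ?thesis .
  qed
  from norm_has_integral_le[OF green_op_has_integral[OF g] int this]
  show ?thesis by (simp add: c_def mult_ac)
qed

text \<open>A bounded solution starts in the ranges of \<open>P\<close> and \<open>Q\<close>: the complementary
  components would have to grow in forward and backward time, respectively.\<close>
lemma bounded_solution_decay:
  assumes z: "\<And>t. (z has_vector_derivative blinfun_apply (A t) (z t)) (at t)"
    and bound: "\<And>t. norm (z t) \<le> M"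
  shows "norm (z t) \<le> N * exp (- \<nu> * \<bar>t\<bar>) * norm (z 0)"
proof -
  have N: "N \<ge> 0" using N_ge_1 by simp
  have zU: "z t = cauchy_op A t (z 0)" for t
    using cauchy_op_solution[OF z] .
  have R: "transported A R 0 \<tau> (z \<tau>) = R (z 0)" for R :: "'a \<Rightarrow>\<^sub>L 'a" and \<tau>
    by (simp add: transported_def cauchy_op_0 zU[of \<tau>])
  have R0: "transported A R t 0 (z 0) = z t" if "R (z 0) = z 0" for R :: "'a \<Rightarrow>\<^sub>L 'a" and t
    by (simp add: transported_def cauchy_op_inv_0 zU[of t] that)
  have le: "norm (B x) \<le> b * N'" if "norm B \<le> b" "norm x \<le> N'" for B :: "'a \<Rightarrow>\<^sub>L 'a" and x b N'
    using that order.trans[OF norm_ge_zero that(1)]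
    by (intro order.trans[OF norm_blinfun] mult_mono) auto
  \<comment> \<open>Transporting \<open>z \<tau>\<close> back to time 0 gives
    \<open>(I - P) z(0)\<close> for every \<open>\<tau> \<ge> 0\<close>, and the trichotomy bound
    for this transport decays in \<open>\<tau>\<close>.\<close>
  have "norm ((id_blinfun - P) (z 0)) \<le> N * M * exp (- \<nu> * \<tau>)" if "\<tau> \<ge> 0" for \<tau>
    using le[OF norm_transported(2)[of \<tau> 0] bound[of \<tau>]] that by (simp add: R mult_ac)
  from zero_of_exponential_bound[OF this \<nu>_pos] have P: "P (z 0) = z 0"
    by (simp add: blinfun.diff_left)
  have "norm ((id_blinfun - Q) (z 0)) \<le> N * M * exp (- \<nu> * \<tau>)" if "\<tau> \<ge> 0" for \<tau>
    using le[OF norm_transported(4)[of "-\<tau>" 0] bound[of "-\<tau>"]] that by (simp add: R mult_ac)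
  from zero_of_exponential_bound[OF this \<nu>_pos] have Q: "Q (z 0) = z 0"
    by (simp add: blinfun.diff_left)
  show ?thesis
  proof (cases "t \<ge> 0")
    case True
    then show ?thesis
      using le[OF norm_transported(1)[of 0 t] order.refl[of "norm (z 0)"]] by (simp add: R0[OF P])
  next
    case False
    then show ?thesis
      using le[OF norm_transported(3)[of 0 t] order.refl[of "norm (z 0)"]] by (simp add: R0[OF Q])
  qed
qed

text \<open>The difference of two bounded solutions of the inhomogeneous equation is a bounded
  solution of the homogeneous one, hence decays away from 0. This replaces the uniqueness of bounded
  solutions that an exponential dichotomy would give.\<close>

lemma bounded_solution_near_green_op:
  assumes v: "\<And>t. (v has_vector_derivative A t (v t) + p t) (at t)" "\<And>t. norm (v t) \<le> Mv"
    and p: "continuous_on UNIV p" "\<And>t. norm (p t) \<le> Mp"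
  shows "norm (v t - green_op p t) \<le> N * exp (- \<nu> * \<bar>t\<bar>) * (Mv + 2 * N / \<nu> * Mp)"
proof -
  have b: "norm (v t - green_op p t) \<le> Mv + 2 * N / \<nu> * Mp" for t
    by (intro norm_triangle_le_diff add_mono v norm_green_op_le p)
  have "((\<lambda>t. v t - green_op p t) has_vector_derivative A t (v t - green_op p t)) (at t)" for t
    using has_vector_derivative_diff[OF v(1) green_op_derivative[OF p]]
    by (simp add: blinfun.diff_right)
  note bounded_solution_decay[OF this b, of t]
  also have "N * exp (- \<nu> * \<bar>t\<bar>) * norm (v 0 - green_op p 0) \<le>
      N * exp (- \<nu> * \<bar>t\<bar>) * (Mv + 2 * N / \<nu> * Mp)"
    using N_ge_1 by (intro mult_left_mono b) auto
  finally show ?thesis .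
qed

end

subsection \<open>Lagrange stability as total boundedness\<close>

text \<open>Total boundedness of an indexed family, expressed on the indices by a closeness relation
  instead of a distance. Different requirements on the same translates can then be imposed together
  by refining covers.\<close>

definition totally_bounded_rel :: "('i \<Rightarrow> 'i \<Rightarrow> bool) \<Rightarrow> bool" where
  "totally_bounded_rel R \<longleftrightarrow>
     (\<exists>\<C>. finite \<C> \<and> \<Union>\<C> = UNIV \<and> (\<forall>C\<in>\<C>. \<forall>i\<in>C. \<forall>j\<in>C. R i j))"

lemma totally_bounded_relI:
  assumes "finite X" "\<And>i. \<exists>x\<in>X. B x i" "\<And>x i j. x \<in> X \<Longrightarrow> B x i \<Longrightarrow> B x j \<Longrightarrow> R i j"
  shows "totally_bounded_rel R"
  unfolding totally_bounded_rel_def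
  by (rule exI[of _ "(\<lambda>x. {i. B x i}) ` X"]) (use assms in auto)

lemma totally_bounded_rel_mono:
  assumes "totally_bounded_rel R" "\<And>i j. R i j \<Longrightarrow> S i j"
  shows "totally_bounded_rel S"
  using assms unfolding totally_bounded_rel_def by meson

lemma totally_bounded_rel_conj:
  assumes "totally_bounded_rel R" "totally_bounded_rel S"
  shows "totally_bounded_rel (\<lambda>i j. R i j \<and> S i j)"
proof -
  obtain \<C> where \<C>: "finite \<C>" "\<Union>\<C> = UNIV" "\<And>C i j. C \<in> \<C> \<Longrightarrow> i \<in> C \<Longrightarrow> j \<in> C \<Longrightarrow> R i j"
    using assms(1) unfolding totally_bounded_rel_def by metis
  obtain \<D> where \<D>: "finite \<D>" "\<Union>\<D> = UNIV" "\<And>C i j. C \<in> \<D> \<Longrightarrow> i \<in> C \<Longrightarrow> j \<in> C \<Longrightarrow> S i j"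
    using assms(2) unfolding totally_bounded_rel_def by metis
  show ?thesis
  proof (rule totally_bounded_relI[where X = "\<C> \<times> \<D>" and B = "\<lambda>x i. i \<in> fst x \<and> i \<in> snd x"])
    fix i
    have "i \<in> \<Union>\<C>" "i \<in> \<Union>\<D>" by (simp_all add: \<C> \<D>)
    then show "\<exists>x\<in>\<C> \<times> \<D>. i \<in> fst x \<and> i \<in> snd x" by auto
  next
    show "R i j \<and> S i j" if "x \<in> \<C> \<times> \<D>" "i \<in> fst x \<and> i \<in> snd x" "j \<in> fst x \<and> j \<in> snd x" for x i j
      using that \<C>(3)[of "fst x" i j] \<D>(3)[of "snd x" i j] by auto
  qed (use \<C> \<D> in simp)
qed

text \<open>The truncation at \<open>1 / (1 + \<bar>t\<bar>)\<close> makes the supremum metrize uniform convergence on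
  compact sets.\<close>
definition ucc_dist :: "(real \<Rightarrow> 'y::metric_space) \<Rightarrow> (real \<Rightarrow> 'y) \<Rightarrow> real" where
  "ucc_dist g h = (SUP t. min (dist (g t) (h t)) (1 / (1 + \<bar>t\<bar>)))"

lemma ucc_dist_upper: "min (dist (g t) (h t)) (1 / (1 + \<bar>t\<bar>)) \<le> ucc_dist g h"
  unfolding ucc_dist_def
proof (rule cSUP_upper)
  show "bdd_above (range (\<lambda>t. min (dist (g t) (h t)) (1 / (1 + \<bar>t\<bar>))))"
    by (rule bdd_aboveI[of _ 1]) (auto simp: min_le_iff_disj)
qed simp

lemma ucc_dist_least:
  assumes "\<And>t. min (dist (g t) (h t)) (1 / (1 + \<bar>t\<bar>)) \<le> e"
  shows "ucc_dist g h \<le> e"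
  unfolding ucc_dist_def using assms by (intro cSUP_least) auto

lemma ucc_dist_le:
  assumes "\<And>t. \<bar>t\<bar> \<le> T \<Longrightarrow> dist (g t) (h t) \<le> e" "1 / (1 + T) \<le> e" "T \<ge> 0"
  shows "ucc_dist g h \<le> e"
proof (rule ucc_dist_least)
  fix t
  have "1 / (1 + \<bar>t\<bar>) \<le> e" if "\<not> \<bar>t\<bar> \<le> T"
    using assms(2,3) that by (intro order.trans[OF _ assms(2)] divide_left_mono) auto
  then show "min (dist (g t) (h t)) (1 / (1 + \<bar>t\<bar>)) \<le> e"
    using assms(1)[of t] by (auto simp: min_le_iff_disj)
qed

lemma dist_less_of_ucc_dist_less:
  assumes "ucc_dist g h < e" "e \<le> 1 / (1 + T)" "\<bar>t\<bar> \<le> T"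
  shows "dist (g t) (h t) < e"
proof -
  have "1 / (1 + T) \<le> 1 / (1 + \<bar>t\<bar>)"
    using assms(3) by (intro divide_left_mono) auto
  then show ?thesis
    using ucc_dist_upper[of g t h] assms by (auto simp: min_le_iff_disj)
qed

lemma small_window:
  fixes e :: real
  assumes "e > 0"
  obtains T where "T \<ge> 0" "1 / (1 + T) \<le> e"
proof
  show "1 / e \<ge> 0" "1 / (1 + 1 / e) \<le> e"
    using assms by (auto simp: field_simps)
qed

section \<open>Metrizability and completeness of uniform convergence on compact sets\<close>

lemma Metric_space_ucc: "Metric_space {g. continuous_on UNIV g} ucc_dist"
proof
  fix g h k :: "real \<Rightarrow> 'a"
  show "0 \<le> ucc_dist g h"
    by (rule order.trans[OF _ ucc_dist_upper[of g 0 h]]) simp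
  show "ucc_dist g h = ucc_dist h g"
    by (simp add: ucc_dist_def dist_commute)
  show "ucc_dist g h = 0 \<longleftrightarrow> g = h"
  proof
    assume "ucc_dist g h = 0"
    then have "min (dist (g t) (h t)) (1 / (1 + \<bar>t\<bar>)) \<le> 0" for t
      using ucc_dist_upper[of g t h] by simp
    moreover have "1 / (1 + \<bar>t\<bar>) > 0" for t :: real by simp
    ultimately have "dist (g t) (h t) \<le> 0" for t
      by (meson min_le_iff_disj not_le)
    then show "g = h" by auto
  next
    assume "g = h"
    moreover have "ucc_dist g g \<le> 0" by (rule ucc_dist_least) (simp add: min_le_iff_disj)
    ultimately show "ucc_dist g h = 0"
      using order.trans[OF _ ucc_dist_upper[of g 0 g], of 0] by simp
  qed
  show "ucc_dist g k \<le> ucc_dist g h + ucc_dist h k"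
  proof (rule ucc_dist_least)
    fix t
    have "min d c \<le> min a c + min b c" if "d \<le> a + b" "0 \<le> a" "0 \<le> b" "0 \<le> c" for a b c d :: real
      using that by (auto simp: min_def)
    then have "min (dist (g t) (k t)) (1 / (1 + \<bar>t\<bar>)) \<le>
        min (dist (g t) (h t)) (1 / (1 + \<bar>t\<bar>)) + min (dist (h t) (k t)) (1 / (1 + \<bar>t\<bar>))"
      by (simp add: dist_triangle)
    then show "min (dist (g t) (k t)) (1 / (1 + \<bar>t\<bar>)) \<le> ucc_dist g h + ucc_dist h k"
      using ucc_dist_upper[of g t h] ucc_dist_upper[of h t k] by linarith
  qed
qed

lemma mtopology_ucc:
  "Metric_space.mtopology {g :: real \<Rightarrow> 'y::metric_space. continuous_on UNIV g} ucc_dist = ucc_topology"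
proof -
  interpret UCC: Metric_space "{g :: real \<Rightarrow> 'y. continuous_on UNIV g}" ucc_dist
    by (rule Metric_space_ucc)
  have 1: "\<exists>r>0. UCC.mball g r \<subseteq> {h. continuous_on UNIV h \<and> (\<forall>t\<in>K. dist (h t) (g t) < e)}"
    if "compact K" "e > 0" for K e and g :: "real \<Rightarrow> 'y"
  proof -
    have "bounded K" using that(1) by (rule compact_imp_bounded)
    then obtain T where T: "0 < T" "\<forall>t\<in>K. norm t \<le> T"
      unfolding bounded_pos by blast
    \<comment> \<open>Below \<open>1 / (1 + T)\<close> the truncation is inactive for times up to
      \<open>T\<close>, so a small \<open>ucc_dist\<close> bounds the true distance on
      \<open>K\<close>.\<close>
    define r where "r = min e (1 / (1 + T))"
    have "dist (h t) (g t) < e" if "ucc_dist g h < r" "t \<in> K" for h t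
      using dist_less_of_ucc_dist_less[OF that(1), of T t] T(2) that(2)
      by (simp add: r_def dist_commute)
    moreover have "r > 0" using that T by (simp add: r_def)
    ultimately show ?thesis by (intro exI[of _ r]) auto
  qed
  have 2: "\<exists>K e. compact K \<and> 0 < e \<and>
      {h. continuous_on UNIV h \<and> (\<forall>t\<in>K. dist (h t) (g t) < e)} \<subseteq> UCC.mball g r"
    if "r > 0" "continuous_on UNIV g" for r and g :: "real \<Rightarrow> 'y"
  proof -
    have "r / 2 > 0" using that by simp
    then obtain T where T: "T \<ge> 0" "1 / (1 + T) \<le> r / 2"
      by (rule small_window)
    have "ucc_dist g h \<le> r / 2" if "\<forall>t\<in>{-T..T}. dist (h t) (g t) < r / 2" for h
      using that T by (intro ucc_dist_le[of T]) (auto simp: dist_commute abs_le_iff less_imp_le)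
    then show ?thesis
      using that by (intro exI[of _ "{-T..T}"] exI[of _ "r / 2"]) fastforce
  qed
  show ?thesis
    unfolding topology_eq openin_ucc_topology UCC.openin_mtopology ucc_open_def
  proof (intro allI iffI conjI ballI)
    fix W :: "(real \<Rightarrow> 'y) set" and g
    assume W: "W \<subseteq> {g. continuous_on UNIV g} \<and> (\<forall>x. x \<in> W \<longrightarrow> (\<exists>r>0. UCC.mball x r \<subseteq> W))" and "g \<in> W"
    then obtain r where r: "r > 0" "UCC.mball g r \<subseteq> W" by blast
    have "continuous_on UNIV g" using W \<open>g \<in> W\<close> by blast
    show "\<exists>K e. compact K \<and> 0 < e \<and> {h. continuous_on UNIV h \<and> (\<forall>t\<in>K. dist (h t) (g t) < e)} \<subseteq> W"
      using 2[OF r(1) \<open>continuous_on UNIV g\<close>] r(2) by (meson order_trans)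
  next
    fix W :: "(real \<Rightarrow> 'y) set" and g
    assume W: "W \<subseteq> {g. continuous_on UNIV g} \<and> (\<forall>g\<in>W. \<exists>K e. compact K \<and> 0 < e \<and>
      {h. continuous_on UNIV h \<and> (\<forall>t\<in>K. dist (h t) (g t) < e)} \<subseteq> W)"
    show "g \<in> W \<longrightarrow> (\<exists>r>0. UCC.mball g r \<subseteq> W)"
    proof
      assume "g \<in> W"
      with W obtain K e where K: "compact K" "0 < e"
        "{h. continuous_on UNIV h \<and> (\<forall>t\<in>K. dist (h t) (g t) < e)} \<subseteq> W" by meson
      show "\<exists>r>0. UCC.mball g r \<subseteq> W"
        using 1[OF K(1,2), of g] K(3) by (meson order_trans)
    qed
  qed auto
qed

text \<open>A Cauchy sequence converges uniformly on every compact interval, hence to a continuous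
  limit. Completeness is what makes total boundedness equivalent to compact closure in
  \<open>lagrange_stable_iff\<close>.\<close>

lemma mcomplete_ucc:
  "Metric_space.mcomplete {g :: real \<Rightarrow> 'y::complete_space. continuous_on UNIV g} ucc_dist"
proof -
  interpret UCC: Metric_space "{g :: real \<Rightarrow> 'y. continuous_on UNIV g}" ucc_dist
    by (rule Metric_space_ucc)
  show ?thesis
    unfolding UCC.mcomplete_def
  proof (intro allI impI)
    fix \<sigma> :: "nat \<Rightarrow> real \<Rightarrow> 'y"
    assume "UCC.MCauchy \<sigma>"
    then have cont: "\<And>n. continuous_on UNIV (\<sigma> n)"
      and Cauchy: "\<And>e. e > 0 \<Longrightarrow> \<exists>N. \<forall>m n. N \<le> m \<longrightarrow> N \<le> n \<longrightarrow> ucc_dist (\<sigma> m) (\<sigma> n) < e"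
      unfolding UCC.MCauchy_def by auto
    have unif: "uniformly_convergent_on {-T..T} \<sigma>" if "T \<ge> 0" for T
    proof (rule Cauchy_uniformly_convergent, unfold uniformly_Cauchy_on_def, intro allI impI)
      fix e :: real assume "e > 0"
      then have "min e (1 / (1 + T)) > 0" using that by simp
      from Cauchy[OF this] obtain N where
        N: "\<And>m n. N \<le> m \<Longrightarrow> N \<le> n \<Longrightarrow> ucc_dist (\<sigma> m) (\<sigma> n) < min e (1 / (1 + T))" by blast
      have "dist (\<sigma> m t) (\<sigma> n t) < e" if "t \<in> {-T..T}" "m \<ge> N" "n \<ge> N" for m n t
        using dist_less_of_ucc_dist_less[OF N[OF that(2,3)], of T t] that(1) by (auto simp: abs_le_iff)
      then show "\<exists>M. \<forall>x\<in>{-T..T}. \<forall>m\<ge>M. \<forall>n\<ge>M. dist (\<sigma> m x) (\<sigma> n x) < e" by blast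
    qed
    define l where "l t = lim (\<lambda>n. \<sigma> n t)" for t
    have ul: "uniform_limit {-T..T} \<sigma> l sequentially" if "T \<ge> 0" for T
      using unif[OF that] unfolding uniformly_convergent_uniform_limit_iff l_def .
    have "continuous_on UNIV l"
    proof (rule continuous_at_imp_continuous_on, rule ballI)
      fix t
      have "continuous_on {- (\<bar>t\<bar> + 1)..\<bar>t\<bar> + 1} l"
        using cont by (intro uniform_limit_theorem[OF _ ul] always_eventually allI)
          (auto intro: continuous_on_subset)
      moreover have "t \<in> interior {- (\<bar>t\<bar> + 1)..\<bar>t\<bar> + 1}"
        by (simp add: interior_atLeastAtMost_real abs_if)
      ultimately show "isCont l t" by (rule continuous_on_interior)
    qed
    moreover have "\<exists>N. \<forall>n\<ge>N. ucc_dist (\<sigma> n) l < e" if "e > 0" for e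
    proof -
      have "e / 2 > 0" using \<open>e > 0\<close> by simp
      then obtain T where T: "T \<ge> 0" "1 / (1 + T) \<le> e / 2"
        by (rule small_window)
      from uniform_limitD[OF ul[OF T(1)], of "e / 2"] \<open>e > 0\<close> obtain N where
        N: "\<forall>n\<ge>N. \<forall>t\<in>{-T..T}. dist (\<sigma> n t) (l t) < e / 2"
        unfolding eventually_sequentially by auto
      have "ucc_dist (\<sigma> n) l \<le> e / 2" if "n \<ge> N" for n
        using N that T by (intro ucc_dist_le[of T]) (auto simp: abs_le_iff intro!: less_imp_le)
      then show ?thesis using \<open>e > 0\<close> by (intro exI[of _ N]) force
    qed
    ultimately show "\<exists>x. limitin UCC.mtopology \<sigma> x sequentially"
      using cont by (intro exI[of _ l]) (auto simp: UCC.limit_metric_sequentially)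
  qed
qed

text \<open>In a complete metric space, compact closure amounts to total boundedness. The metric
  \<open>ucc_dist\<close> is traded for closeness on arbitrary windows \<open>|t| \<le> T\<close>,
  the form in which Lagrange stability is verified and used from here on.\<close>

lemma lagrange_stable_iff:
  fixes g :: "real \<Rightarrow> 'y::complete_space"
  shows "lagrange_stable g \<longleftrightarrow> continuous_on UNIV g \<and>
    (\<forall>T e. 0 < e \<longrightarrow> totally_bounded_rel (\<lambda>h h'. \<forall>t. \<bar>t\<bar> \<le> T \<longrightarrow> dist (g (t + h)) (g (t + h')) \<le> e))"
    (is "_ \<longleftrightarrow> ?cont \<and> ?tb")
proof -
  interpret UCC: Metric_space "{g :: real \<Rightarrow> 'y. continuous_on UNIV g}" ucc_dist
    by (rule Metric_space_ucc)
  define S where "S h t = g (t + h)" for h t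
  have range_S: "range (\<lambda>h t. g (t + h)) = range S" by (simp add: S_def fun_eq_iff image_def)
  have "S 0 = g" by (simp add: S_def fun_eq_iff)
  moreover have "continuous_on UNIV (S h)" if ?cont for h
    unfolding S_def by (rule continuous_on_compose2[OF that]) (auto intro!: continuous_intros)
  ultimately have sub: "range S \<subseteq> {g. continuous_on UNIV g} \<longleftrightarrow> ?cont"
    by (force simp: image_subset_iff)
  have "lagrange_stable g \<longleftrightarrow> UCC.mtotally_bounded (range S)"
    unfolding lagrange_stable_def precompact_in_def range_S topspace_ucc_topology
    using UCC.mtotally_bounded_eq_compact_closure_of[OF mcomplete_ucc, of "range S"]
    by (simp add: mtopology_ucc)
  also have "\<dots> \<longleftrightarrow> ?cont \<and> ?tb"
  proof (intro iffI conjI allI impI)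
    assume tb: "UCC.mtotally_bounded (range S)"
    then show ?cont using UCC.mtotally_bounded_imp_subset sub by blast
    fix T e :: real assume "e > 0"
    \<comment> \<open>Two translates near a common centre cost \<open>e / 2\<close> each;
      \<open>max 0 T\<close> accounts for negative \<open>T\<close>, where the window is
      empty.\<close>
    define r where "r = min (e / 2) (1 / (1 + max 0 T))"
    have "r > 0" using \<open>e > 0\<close> by (simp add: r_def)
    with tb obtain X where X: "finite X" "range S \<subseteq> (\<Union>x\<in>X. UCC.mball x r)"
      unfolding UCC.mtotally_bounded_def by blast
    show "totally_bounded_rel (\<lambda>h h'. \<forall>t. \<bar>t\<bar> \<le> T \<longrightarrow> dist (g (t + h)) (g (t + h')) \<le> e)"
    proof (rule totally_bounded_relI[OF X(1), where B = "\<lambda>x h. ucc_dist x (S h) < r"])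
      show "\<exists>x\<in>X. ucc_dist x (S i) < r" for i
        using subsetD[OF X(2), of "S i"] by auto
      show "\<forall>t. \<bar>t\<bar> \<le> T \<longrightarrow> dist (g (t + h)) (g (t + h')) \<le> e"
        if "ucc_dist x (S h) < r" "ucc_dist x (S h') < r" for x h h'
      proof (intro allI impI)
        fix t assume t: "\<bar>t\<bar> \<le> T"
        have "dist (x t) (S k t) < e / 2" if "ucc_dist x (S k) < r" for k
          using dist_less_of_ucc_dist_less[OF that, of "max 0 T" t] t by (simp add: r_def)
        from this[OF that(1)] this[OF that(2)] have "dist (S h t) (S h' t) < e / 2 + e / 2"
          by (metis dist_commute dist_triangle_lt add_strict_mono)
        then show "dist (g (t + h)) (g (t + h')) \<le> e" by (simp add: S_def)
      qed
    qed
  next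
    assume tb: "?cont \<and> ?tb"
    show "UCC.mtotally_bounded (range S)"
      unfolding UCC.mtotally_bounded_def
    proof (intro allI impI)
      fix e :: real assume "e > 0"
      then have e2: "e / 2 > 0" by simp
      then obtain T where T: "T \<ge> 0" "1 / (1 + T) \<le> e / 2"
        by (rule small_window)
      have "totally_bounded_rel (\<lambda>h h'. \<forall>t. \<bar>t\<bar> \<le> T \<longrightarrow> dist (g (t + h)) (g (t + h')) \<le> e / 2)"
        using tb e2 by blast
      then obtain \<C> where \<C>: "finite \<C>" "\<Union>\<C> = UNIV"
        "\<And>C h h' t. C \<in> \<C> \<Longrightarrow> h \<in> C \<Longrightarrow> h' \<in> C \<Longrightarrow> \<bar>t\<bar> \<le> T \<Longrightarrow> dist (g (t + h)) (g (t + h')) \<le> e / 2"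
        unfolding totally_bounded_rel_def by metis
      \<comment> \<open>The centres must themselves be translates of \<open>g\<close>, so each class
        is represented by one of its elements; an empty class yields some translate, which does no
        harm.\<close>
      define rep where "rep C = (SOME h. h \<in> C)" for C :: "real set"
      have "S h \<in> (\<Union>x\<in>S ` rep ` \<C>. UCC.mball x e)" for h
      proof -
        obtain C where C: "C \<in> \<C>" "h \<in> C" using \<C>(2) by blast
        then have "rep C \<in> C" unfolding rep_def by (metis someI)
        then have "ucc_dist (S (rep C)) (S h) \<le> e / 2"
          using C \<C>(3) T by (intro ucc_dist_le[of T]) (auto simp: S_def)
        then have "S h \<in> UCC.mball (S (rep C)) e"
          using \<open>e > 0\<close> sub tb by (auto simp: UCC.in_mball)
        then show ?thesis using C by blast
      qed
      then show "\<exists>K. finite K \<and> K \<subseteq> range S \<and> range S \<subseteq> (\<Union>x\<in>K. UCC.mball x e)"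
        using \<C>(1) by (intro exI[of _ "S ` rep ` \<C>"]) auto
    qed
  qed
  finally show ?thesis .
qed

section \<open>Compact range, sums and superpositions of Lagrange stable functions\<close>

lemma lagrange_stable_imp_continuous:
  "lagrange_stable (g :: real \<Rightarrow> 'y::complete_space) \<Longrightarrow> continuous_on UNIV g"
  by (simp add: lagrange_stable_iff)

lemma lagrange_stable_imp_totally_bounded_rel:
  "lagrange_stable (g :: real \<Rightarrow> 'y::complete_space) \<Longrightarrow> 0 < e \<Longrightarrow>
    totally_bounded_rel (\<lambda>h h'. \<forall>t. \<bar>t\<bar> \<le> T \<longrightarrow> dist (g (t + h)) (g (t + h')) \<le> e)"
  by (simp add: lagrange_stable_iff)

text \<open>The window consisting of \<open>t = 0\<close> alone sees the value \<open>g h\<close> of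
  the translate by \<open>h\<close>, so a finite cover of the shifts covers the range by finitely
  many small balls.\<close>

lemma lagrange_stable_compact_closure_range:
  fixes g :: "real \<Rightarrow> 'y::complete_space"
  assumes "lagrange_stable g"
  shows "compact (closure (range g))"
  unfolding compact_eq_totally_bounded
proof (intro conjI allI impI)
  show "complete (closure (range g))" by (simp add: complete_eq_closed)
  fix e :: real assume "e > 0"
  then have "totally_bounded_rel (\<lambda>h h'. \<forall>t. \<bar>t\<bar> \<le> 0 \<longrightarrow> dist (g (t + h)) (g (t + h')) \<le> e / 2)"
    by (intro lagrange_stable_imp_totally_bounded_rel assms) simp
  then have "totally_bounded_rel (\<lambda>h h'. dist (g h) (g h') \<le> e / 2)"
    by (rule totally_bounded_rel_mono) simp
  then obtain \<C> where \<C>: "finite \<C>" "\<Union>\<C> = UNIV"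
    "\<And>C h h'. C \<in> \<C> \<Longrightarrow> h \<in> C \<Longrightarrow> h' \<in> C \<Longrightarrow> dist (g h) (g h') \<le> e / 2"
    unfolding totally_bounded_rel_def by metis
  define rep where "rep C = (SOME h. h \<in> C)" for C :: "real set"
  have "g h \<in> (\<Union>C\<in>\<C>. cball (g (rep C)) (e / 2))" for h
  proof -
    obtain C where C: "C \<in> \<C>" "h \<in> C" using \<C>(2) by blast
    then have "rep C \<in> C" unfolding rep_def by (metis someI)
    then show ?thesis using C \<C>(3)[OF C(1) _ C(2)] by auto
  qed
  then have "range g \<subseteq> (\<Union>C\<in>\<C>. cball (g (rep C)) (e / 2))" by blast
  then have "closure (range g) \<subseteq> (\<Union>C\<in>\<C>. cball (g (rep C)) (e / 2))"
    using \<C>(1) by (intro closure_minimal closed_UN) auto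
  also have "\<dots> \<subseteq> (\<Union>x\<in>(g \<circ> rep) ` \<C>. ball x e)"
    using \<open>e > 0\<close> by auto
  finally show "\<exists>k. finite k \<and> closure (range g) \<subseteq> (\<Union>x\<in>k. ball x e)"
    using \<C>(1) by (intro exI[of _ "(g \<circ> rep) ` \<C>"]) auto
qed

lemma lagrange_stable_bounded:
  fixes g :: "real \<Rightarrow> 'y::{complete_space, real_normed_vector}"
  assumes "lagrange_stable g"
  obtains M where "\<And>t. norm (g t) \<le> M"
proof -
  have "bounded (range g)"
    using lagrange_stable_compact_closure_range[OF assms]
    by (meson bounded_subset closure_subset compact_imp_bounded)
  then show thesis using that unfolding bounded_iff by auto
qed

lemma lagrange_stable_add:
  fixes f g :: "real \<Rightarrow> 'y::banach"
  assumes "lagrange_stable f" "lagrange_stable g"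
  shows "lagrange_stable (\<lambda>t. f t + g t)"
  unfolding lagrange_stable_iff
proof (intro conjI allI impI)
  show "continuous_on UNIV (\<lambda>t. f t + g t)"
    using assms by (intro continuous_on_add lagrange_stable_imp_continuous)
  fix T e :: real assume "e > 0"
  then have "e / 2 > 0" by simp
  note lagrange_stable_imp_totally_bounded_rel[OF assms(1) this, of T]
    lagrange_stable_imp_totally_bounded_rel[OF assms(2) this, of T]
  from totally_bounded_rel_conj[OF this]
  show "totally_bounded_rel (\<lambda>h h'. \<forall>t. \<bar>t\<bar> \<le> T \<longrightarrow>
      dist (f (t + h) + g (t + h)) (f (t + h') + g (t + h')) \<le> e)"
  proof (rule totally_bounded_rel_mono, intro allI impI, elim conjE)
    fix h h' t assume "\<forall>t. \<bar>t\<bar> \<le> T \<longrightarrow> dist (f (t + h)) (f (t + h')) \<le> e / 2"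
      "\<forall>t. \<bar>t\<bar> \<le> T \<longrightarrow> dist (g (t + h)) (g (t + h')) \<le> e / 2" "\<bar>t\<bar> \<le> T"
    then show "dist (f (t + h) + g (t + h)) (f (t + h') + g (t + h')) \<le> e"
      using dist_triangle_add[of "f (t + h)" "g (t + h)" "f (t + h')" "g (t + h')"] by force
  qed
qed

text \<open>Finitely many subbasic sets force uniform closeness on \<open>C\<close>: the compact
  image of \<open>C\<close> under \<open>G\<close> is covered by balls of radius
  \<open>e / 4\<close>, and on the compact part of \<open>C\<close> that \<open>G\<close> maps
  within \<open>e / 4\<close> of a centre, every member of \<open>U\<close> stays within
  \<open>e / 2\<close> of it.\<close>

lemma compact_open_small_neighbourhood:
  fixes G :: "'x::t2_space \<Rightarrow> 'y::metric_space"
  assumes G: "continuous_on UNIV G" and C: "compact C" and e: "e > 0"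
  obtains U where "openin compact_open_topology U" "G \<in> U"
    "\<And>g g' x. g \<in> U \<Longrightarrow> g' \<in> U \<Longrightarrow> x \<in> C \<Longrightarrow> dist (g x) (g' x) < e"
proof -
  have "compact (G ` C)"
    using G C by (intro compact_continuous_image continuous_on_subset[OF G]) auto
  then obtain Y where Y: "finite Y" "G ` C \<subseteq> (\<Union>y\<in>Y. ball y (e / 4))"
    using e unfolding compact_eq_totally_bounded by (meson divide_pos_pos zero_less_numeral)
  define K where "K y = C \<inter> G -` cball y (e / 4)" for y
  \<comment> \<open>Intersecting with the carrier keeps \<open>U\<close> open when \<open>Y\<close>
    is empty.\<close>
  define U where "U = (\<Inter>y\<in>Y. {g. continuous_on UNIV g \<and> g ` K y \<subseteq> ball y (e / 2)})
    \<inter> topspace compact_open_topology"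
  have K: "compact (K y)" for y
    unfolding K_def using G C
    by (intro compact_Int_closed C continuous_closed_vimage) (auto simp: continuous_on_eq_continuous_at)
  show thesis
  proof
    show "openin compact_open_topology U"
      unfolding U_def
    proof (rule openin_INT[OF Y(1)])
      fix y
      show "openin compact_open_topology {g. continuous_on UNIV g \<and> g ` K y \<subseteq> ball y (e / 2)}"
        unfolding compact_open_topology_def using K[of y]
        by (intro topology_generated_by_Basis) (auto intro!: exI[of _ "K y"] exI[of _ "ball y (e / 2)"])
    qed
    show "G \<in> U"
      using G e by (auto simp: U_def K_def topspace_compact_open_topology)
    fix g g' x assume g: "g \<in> U" "g' \<in> U" and x: "x \<in> C"
    obtain y where y: "y \<in> Y" "G x \<in> ball y (e / 4)" using Y(2) x by blast
    then have "x \<in> K y" using x by (simp add: K_def)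
    then have "g x \<in> ball y (e / 2)" "g' x \<in> ball y (e / 2)"
      using g y(1) unfolding U_def by blast+
    then show "dist (g x) (g' x) < e"
      by (metis dist_triangle_half_r mem_ball)
  qed
qed

text \<open>The compact-open topology on functions of \<open>(t, x)\<close> need not be metrizable,
  so the finite cover comes straight from compactness: the closure of the translates is covered by
  small neighbourhoods from the previous lemma.\<close>

lemma lagrange_stable2_imp_totally_bounded_rel:
  fixes F :: "real \<times> 'x::t2_space \<Rightarrow> 'y::metric_space"
  assumes F: "lagrange_stable2 F" and C: "compact C" and e: "e > 0"
  shows "totally_bounded_rel (\<lambda>h h'. \<forall>(t, x)\<in>C. dist (F (t + h, x)) (F (t + h', x)) < e)"
proof -
  define S where "S h = (\<lambda>(t, x). F (t + h, x))" for h
  let ?X = "compact_open_topology :: (real \<times> 'x \<Rightarrow> 'y) topology"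
  have S: "range S \<subseteq> topspace ?X" "compactin ?X (?X closure_of range S)"
    using F unfolding lagrange_stable2_def precompact_in_def S_def by auto
  define \<U> where "\<U> = {U. openin ?X U \<and> (\<forall>g\<in>U. \<forall>g'\<in>U. \<forall>x\<in>C. dist (g x) (g' x) < e)}"
  have "?X closure_of range S \<subseteq> \<Union>\<U>"
  proof
    fix G assume "G \<in> ?X closure_of range S"
    then have "continuous_on UNIV G"
      using closure_of_subset_topspace by (force simp: topspace_compact_open_topology)
    then obtain U where "openin ?X U" "G \<in> U"
      "\<And>g g' x. g \<in> U \<Longrightarrow> g' \<in> U \<Longrightarrow> x \<in> C \<Longrightarrow> dist (g x) (g' x) < e"
      using compact_open_small_neighbourhood C e by blast
    then show "G \<in> \<Union>\<U>" unfolding \<U>_def by blast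
  qed
  then obtain \<V> where \<V>: "finite \<V>" "\<V> \<subseteq> \<U>" "?X closure_of range S \<subseteq> \<Union>\<V>"
    using compactinD[OF S(2), of \<U>] unfolding \<U>_def by blast
  have "S h \<in> \<Union>\<V>" for h
    using closure_of_subset[OF S(1)] \<V>(3) by blast
  then show ?thesis
    using \<V>(1,2) by (intro totally_bounded_relI[of \<V> "\<lambda>U h. S h \<in> U"])
      (fastforce simp: \<U>_def S_def)+
qed

text \<open>The values of \<open>\<phi>\<close> stay in a compact set, so the translates of
  \<open>F\<close> are compared only on the compact set \<open>C\<close>. Changing the second
  argument of \<open>F\<close> costs the Lipschitz constant times the change of
  \<open>\<phi>\<close>.\<close>

lemma lagrange_stable_compose:
  fixes F :: "real \<times> 'x::banach \<Rightarrow> 'y::banach"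
  assumes cont: "continuous_on UNIV F" and F: "lagrange_stable2 F"
    and lip: "\<And>t u v. norm (F (t, u) - F (t, v)) \<le> L * norm (u - v)"
    and \<phi>: "lagrange_stable \<phi>"
  shows "lagrange_stable (\<lambda>t. F (t, \<phi> t))"
  unfolding lagrange_stable_iff
proof (intro conjI allI impI)
  show "continuous_on UNIV (\<lambda>t. F (t, \<phi> t))"
    using lagrange_stable_imp_continuous[OF \<phi>]
    by (intro continuous_on_compose2[OF cont] continuous_intros) auto
  fix T e :: real assume e: "e > 0"
  define C where "C = {-T..T} \<times> closure (range \<phi>)"
  \<comment> \<open>Adding 1 in the denominator keeps \<open>d\<close> positive when
    \<open>L = 0\<close>.\<close>
  define d where "d = e / (2 * (\<bar>L\<bar> + 1))"
  have d: "d > 0" "\<bar>L\<bar> * d \<le> e / 2" using e by (auto simp: d_def field_simps)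
  have "compact C"
    unfolding C_def by (intro compact_Times lagrange_stable_compact_closure_range[OF \<phi>]) simp
  from lagrange_stable2_imp_totally_bounded_rel[OF F this, of "e / 2"] e
  have "totally_bounded_rel (\<lambda>h h'. \<forall>(t, x)\<in>C. dist (F (t + h, x)) (F (t + h', x)) < e / 2)"
    by simp
  from totally_bounded_rel_conj[OF this lagrange_stable_imp_totally_bounded_rel[OF \<phi> d(1), of T]]
  show "totally_bounded_rel (\<lambda>h h'. \<forall>t. \<bar>t\<bar> \<le> T \<longrightarrow>
      dist (F (t + h, \<phi> (t + h))) (F (t + h', \<phi> (t + h'))) \<le> e)"
  proof (rule totally_bounded_rel_mono, intro allI impI, elim conjE)
    fix h h' t
    assume 1: "\<forall>(t, x)\<in>C. dist (F (t + h, x)) (F (t + h', x)) < e / 2"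
      and 2: "\<forall>t. \<bar>t\<bar> \<le> T \<longrightarrow> dist (\<phi> (t + h)) (\<phi> (t + h')) \<le> d" and t: "\<bar>t\<bar> \<le> T"
    have "(t, \<phi> (t + h)) \<in> C"
      using t closure_subset[of "range \<phi>"] by (auto simp: C_def abs_le_iff)
    then have "dist (F (t + h, \<phi> (t + h))) (F (t + h', \<phi> (t + h))) < e / 2" using 1 by auto
    moreover have "dist (F (t + h', \<phi> (t + h))) (F (t + h', \<phi> (t + h'))) \<le> \<bar>L\<bar> * d"
      unfolding dist_norm using 2 t
      by (intro order.trans[OF lip] mult_mono) (auto simp: dist_norm)
    ultimately show "dist (F (t + h, \<phi> (t + h))) (F (t + h', \<phi> (t + h'))) \<le> e"
      using d(2) dist_triangle[of "F (t + h, \<phi> (t + h))" "F (t + h', \<phi> (t + h'))" "F (t + h', \<phi> (t + h))"]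
      by linarith
  qed
qed

subsection \<open>Lagrange stability of Green integrals\<close>

lemma exponential_eventually_small:
  fixes C a e :: real
  assumes "a > 0" "e > 0"
  obtains T where "T \<ge> 0" "C * exp (- a * T) \<le> e"
proof (cases "C \<le> 0")
  case True
  then show thesis using assms by (intro that[of 0]) auto
next
  case False
  define T where "T = C / (a * e)"
  have "a * T = C / e" using assms by (simp add: T_def)
  then have "C / e \<le> exp (a * T)"
    using exp_ge_add_one_self[of "a * T"] by linarith
  then have "C * exp (- a * T) \<le> e"
    using assms by (simp add: exp_minus field_simps)
  moreover have "T \<ge> 0" using False assms by (simp add: T_def)
  ultimately show thesis using that by blast
qed

text \<open>Separates two mechanisms for Green integrals: distant shifts form one class, labelled
  \<open>None\<close>, where exponential decay applies; the remaining compact interval is covered by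
  pieces of size at most \<open>\<eta>\<close>, where Lipschitz continuity suffices.\<close>

lemma totally_bounded_rel_close_or_far:
  fixes H :: real
  assumes "\<eta> > 0"
  shows "totally_bounded_rel (\<lambda>h h'. (H < \<bar>h\<bar> \<and> H < \<bar>h'\<bar>) \<or> \<bar>h - h'\<bar> \<le> \<eta>)"
proof -
  obtain k where k: "finite k" "{-H..H} \<subseteq> (\<Union>x\<in>k. ball x (\<eta> / 2))"
    using compact_Icc[of "-H" H] half_gt_zero[OF assms] unfolding compact_eq_totally_bounded by blast
  show ?thesis
  proof (rule totally_bounded_relI[where X = "insert None (Some ` k)"
        and B = "\<lambda>x h. case x of None \<Rightarrow> H < \<bar>h\<bar> | Some y \<Rightarrow> dist y h < \<eta> / 2"])
    show "\<exists>x\<in>insert None (Some ` k). case x of None \<Rightarrow> H < \<bar>h\<bar> | Some y \<Rightarrow> dist y h < \<eta> / 2" for h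
    proof (cases "H < \<bar>h\<bar>")
      case False
      then have "h \<in> {-H..H}" by auto
      then have "h \<in> (\<Union>x\<in>k. ball x (\<eta> / 2))" using k(2) by blast
      then show ?thesis by auto
    qed auto
    show "(H < \<bar>h\<bar> \<and> H < \<bar>h'\<bar>) \<or> \<bar>h - h'\<bar> \<le> \<eta>"
      if "case x of None \<Rightarrow> H < \<bar>h\<bar> | Some y \<Rightarrow> dist y h < \<eta> / 2"
        "case x of None \<Rightarrow> H < \<bar>h'\<bar> | Some y \<Rightarrow> dist y h' < \<eta> / 2" for x h h'
    proof (cases x)
      case (Some y)
      then have "\<bar>y - h\<bar> < \<eta> / 2" "\<bar>y - h'\<bar> < \<eta> / 2" using that by (simp_all add: dist_real_def)
      then have "\<bar>h - h'\<bar> \<le> \<eta>" by arith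
      then show ?thesis ..
    qed (use that in simp)
  qed (use k in simp)
qed

lemma lagrange_stable_uniform_limit:
  fixes \<phi> :: "real \<Rightarrow> 'y::complete_space"
  assumes cont: "continuous_on UNIV \<phi>"
    and approx: "\<And>e. e > 0 \<Longrightarrow> \<exists>\<psi>. lagrange_stable \<psi> \<and> (\<forall>t. dist (\<psi> t) (\<phi> t) \<le> e)"
  shows "lagrange_stable \<phi>"
  unfolding lagrange_stable_iff
proof (intro conjI allI impI cont)
  fix T e :: real assume "e > 0"
  then have e: "e / 3 > 0" by simp
  obtain \<psi> where \<psi>: "lagrange_stable \<psi>" "\<And>t. dist (\<psi> t) (\<phi> t) \<le> e / 3"
    using approx[OF e] by blast
  show "totally_bounded_rel (\<lambda>h h'. \<forall>t. \<bar>t\<bar> \<le> T \<longrightarrow> dist (\<phi> (t + h)) (\<phi> (t + h')) \<le> e)"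
  proof (rule totally_bounded_rel_mono[OF lagrange_stable_imp_totally_bounded_rel[OF \<psi>(1) e, of T]],
      intro allI impI)
    fix h h' t assume "\<forall>t. \<bar>t\<bar> \<le> T \<longrightarrow> dist (\<psi> (t + h)) (\<psi> (t + h')) \<le> e / 3" "\<bar>t\<bar> \<le> T"
    then have "dist (\<psi> (t + h)) (\<psi> (t + h')) \<le> e / 3" by blast
    then show "dist (\<phi> (t + h)) (\<phi> (t + h')) \<le> e"
      using \<psi>(2)[of "t + h"] \<psi>(2)[of "t + h'"] dist_triangle[of "\<phi> (t + h)" "\<phi> (t + h')" "\<psi> (t + h)"]
        dist_triangle[of "\<psi> (t + h)" "\<phi> (t + h')" "\<psi> (t + h')"] dist_commute[of "\<psi> (t + h)" "\<phi> (t + h)"]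
      by linarith
  qed
qed

context trichotomy
begin

text \<open>With \<open>v\<close> the difference of the Green integral and its translate, the first
  summand bounds the distance of \<open>v\<close> from the Green integral of its inhomogeneity
  \<open>p\<close>. The second bounds that integral, near \<open>t\<close> by the closeness
  \<open>d\<close> and farther away by the crude bound \<open>Mp\<close>.\<close>

lemma green_op_translate_diff:
  assumes g: "continuous_on UNIV g" "\<And>t. norm (g t) \<le> M"
    and near: "\<And>\<tau>. \<bar>\<tau> - t\<bar> \<le> T \<Longrightarrow> norm (A \<tau> - A (\<tau> + s)) \<le> d \<and> norm (g \<tau> - g (\<tau> + s)) \<le> d"
    and "T \<ge> 0"
  defines "M' \<equiv> 2 * N / \<nu> * M"
  defines "Mp \<equiv> 2 * \<alpha> * M' + 2 * M"
  shows "norm (green_op g t - green_op g (t + s)) \<le> N * exp (- \<nu> * \<bar>t\<bar>) * (2 * M' + 2 * N / \<nu> * Mp)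
    + (2 * N / \<nu> * (d * M' + d) + 4 * N / \<nu> * Mp * exp (- \<nu> / 2 * T))"
proof -
  let ?\<phi> = "green_op g"
  define v where "v \<tau> = ?\<phi> \<tau> - ?\<phi> (\<tau> + s)" for \<tau>
  \<comment> \<open>Comes from subtracting the two equations and splitting
    \<open>A(\<tau>) \<phi>(\<tau>) - A(\<tau> + s) \<phi>(\<tau> + s)\<close> as \<open>A(\<tau>)
    v(\<tau>) + (A(\<tau>) - A(\<tau> + s)) \<phi>(\<tau> + s)\<close>.\<close>
  define p where "p \<tau> = (A \<tau> - A (\<tau> + s)) (?\<phi> (\<tau> + s)) + (g \<tau> - g (\<tau> + s))" for \<tau>
  have \<phi>: "norm (?\<phi> \<tau>) \<le> M'" for \<tau>
    unfolding M'_def by (rule norm_green_op_le[OF g])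
  have M': "M' \<ge> 0" using order.trans[OF norm_ge_zero \<phi>[of 0]] .
  have "norm (A t - A (t + s)) \<le> d" using near[of t] \<open>T \<ge> 0\<close> by simp
  then have d: "d \<ge> 0" by (rule order.trans[OF norm_ge_zero])
  have shift: "((\<lambda>\<tau>. ?\<phi> (\<tau> + s)) has_vector_derivative A (\<tau> + s) (?\<phi> (\<tau> + s)) + g (\<tau> + s)) (at \<tau>)" for \<tau>
  proof -
    have "((\<lambda>\<tau>. \<tau> + s) has_vector_derivative 1) (at \<tau>)"
      by (auto intro!: derivative_eq_intros)
    from vector_diff_chain_at[OF this green_op_derivative[OF g]] show ?thesis by (simp add: o_def)
  qed
  have v': "(v has_vector_derivative A \<tau> (v \<tau>) + p \<tau>) (at \<tau>)" for \<tau>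
    using has_vector_derivative_diff[OF green_op_derivative[OF g, of \<tau>] shift[of \<tau>]]
    by (simp add: v_def[abs_def] p_def blinfun.bilinear_simps algebra_simps)
  have v: "norm (v \<tau>) \<le> 2 * M'" for \<tau>
    using norm_triangle_ineq4[of "?\<phi> \<tau>" "?\<phi> (\<tau> + s)"] \<phi>[of \<tau>] \<phi>[of "\<tau> + s"] by (simp add: v_def)
  have comp: "continuous_on UNIV (\<lambda>\<tau>. h (\<tau> + s))" if "continuous_on UNIV h" for h :: "real \<Rightarrow> 'z::real_normed_vector"
    by (rule continuous_on_compose2[OF that]) (auto intro!: continuous_intros)
  have p_cont: "continuous_on UNIV p"
    unfolding p_def
    by (intro continuous_intros blinfun.continuous_on continuous_A g comp green_op_continuous[OF g])
  have p_le: "norm (p \<tau>) \<le> norm (A \<tau> - A (\<tau> + s)) * M' + norm (g \<tau> - g (\<tau> + s))" for \<tau>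
    unfolding p_def by (intro norm_triangle_le add_right_mono order.trans[OF norm_blinfun] mult_left_mono \<phi>) auto
  have "norm (p \<tau>) \<le> Mp" for \<tau>
  proof -
    have "norm (A \<tau> - A (\<tau> + s)) \<le> 2 * \<alpha>"
      using norm_triangle_ineq4[of "A \<tau>" "A (\<tau> + s)"] bounded_A[of \<tau>] bounded_A[of "\<tau> + s"] by simp
    moreover have "norm (g \<tau> - g (\<tau> + s)) \<le> 2 * M"
      using norm_triangle_ineq4[of "g \<tau>" "g (\<tau> + s)"] g(2)[of \<tau>] g(2)[of "\<tau> + s"] by simp
    ultimately show ?thesis
      unfolding Mp_def using M' by (intro order.trans[OF p_le] add_mono mult_right_mono)
  qed
  note p = p_cont this
  have "norm (p \<tau>) \<le> d * M' + d" if "\<bar>\<tau> - t\<bar> \<le> T" for \<tau>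
    using near[OF that] M' by (intro order.trans[OF p_le] add_mono mult_right_mono) auto
  then have "norm (green_op p t) \<le> 2 * N / \<nu> * (d * M' + d) + 4 * N / \<nu> * Mp * exp (- \<nu> / 2 * T)"
    using d M' by (intro norm_green_op_local[OF p]) auto
  moreover have "norm (v t - green_op p t) \<le> N * exp (- \<nu> * \<bar>t\<bar>) * (2 * M' + 2 * N / \<nu> * Mp)"
    by (rule bounded_solution_near_green_op[OF v' v p])
  moreover have "norm (v t) \<le> norm (v t - green_op p t) + norm (green_op p t)"
    using norm_triangle_sub[of "v t" "green_op p t"] by simp
  ultimately show ?thesis unfolding v_def by linarith
qed

text \<open>The differential equation bounds the derivative. The estimate serves shifts near 0,
  where the decay in \<open>green_op_translate_diff\<close> is of no help.\<close>

lemma green_op_lipschitz: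
  assumes g: "continuous_on UNIV g" "\<And>t. norm (g t) \<le> M"
  shows "norm (green_op g t - green_op g s) \<le> (\<alpha> * (2 * N / \<nu> * M) + M) * \<bar>t - s\<bar>"
proof -
  let ?C = "\<alpha> * (2 * N / \<nu> * M) + M"
  have "norm (green_op g t - green_op g s) \<le> ?C * norm (t - s)"
  proof (rule differentiable_bound[of UNIV])
    fix x
    have "norm (A x (green_op g x) + g x) \<le> ?C"
      using order.trans[OF norm_ge_zero bounded_A]
      by (intro norm_triangle_le add_mono g order.trans[OF norm_blinfun] mult_mono bounded_A
          norm_green_op_le[OF g]) auto
    then show "onorm (\<lambda>y. y *\<^sub>R (A x (green_op g x) + g x)) \<le> ?C"
      by (intro onorm_bound) (auto simp: mult.commute intro!: mult_left_mono intro: order.trans[OF norm_ge_zero])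
    show "(green_op g has_derivative (\<lambda>y. y *\<^sub>R (A x (green_op g x) + g x))) (at x within UNIV)"
      using green_op_derivative[OF g, of x] by (simp add: has_vector_derivative_def)
  qed auto
  then show ?thesis by simp
qed

text \<open>Shifts in a common class of the finite cover have close translates of \<open>A\<close>
  and \<open>g\<close>, and are either both distant or close to each other. The first case is
  settled by \<open>green_op_translate_diff\<close>, the second by
  \<open>green_op_lipschitz\<close>.\<close>

lemma lagrange_stable_green_op:
  assumes A: "lagrange_stable A" and g: "lagrange_stable g"
  shows "lagrange_stable (green_op g)"
proof -
  obtain M where M: "\<And>t. norm (g t) \<le> M" using lagrange_stable_bounded[OF g] by blast
  note g' = lagrange_stable_imp_continuous[OF g] M
  define M' where "M' = 2 * N / \<nu> * M"
  define Mp where "Mp = 2 * \<alpha> * M' + 2 * M"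
  define \<Lambda> where "\<Lambda> = \<alpha> * M' + M"
  have M0: "M \<ge> 0" using order.trans[OF norm_ge_zero M[of 0]] .
  have \<alpha>: "\<alpha> \<ge> 0" using order.trans[OF norm_ge_zero bounded_A[of 0]] .
  have M': "M' \<ge> 0" using M0 N_ge_1 \<nu>_pos by (simp add: M'_def)
  have \<Lambda>: "\<Lambda> \<ge> 0" using \<alpha> M' M0 by (simp add: \<Lambda>_def)
  show ?thesis
    unfolding lagrange_stable_iff
  proof (intro conjI allI impI green_op_continuous[OF g'])
    fix T0 e :: real assume e: "e > 0"
    define T where "T = max 0 T0"
    have e3: "e / 3 > 0" and \<nu>2: "\<nu> / 2 > 0" using e \<nu>_pos by auto
    \<comment> \<open>\<open>T'\<close>, \<open>H\<close> and \<open>d\<close> make each of three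
      terms in \<open>green_op_translate_diff\<close> at most \<open>e / 3\<close>: the tail of the
      integral, the decaying difference of bounded solutions, and the local perturbation.\<close>
    obtain T' where T': "T' \<ge> 0" "4 * N / \<nu> * Mp * exp (- (\<nu> / 2) * T') \<le> e / 3"
      by (rule exponential_eventually_small[OF \<nu>2 e3])
    obtain H where H: "H \<ge> 0" "N * (2 * M' + 2 * N / \<nu> * Mp) * exp (- \<nu> * H) \<le> e / 3"
      by (rule exponential_eventually_small[OF \<nu>_pos e3])
    define d where "d = e / 3 * \<nu> / (2 * N) / (M' + 1)"
    have d: "d > 0" "2 * N / \<nu> * (d * M' + d) = e / 3"
    proof -
      show "d > 0" using e \<nu>_pos N_ge_1 M' by (simp add: d_def)
      have "d * M' + d = d * (M' + 1)" by (simp add: algebra_simps)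
      also have "\<dots> = e / 3 * \<nu> / (2 * N)" using M' by (simp add: d_def)
      finally show "2 * N / \<nu> * (d * M' + d) = e / 3" using \<nu>_pos N_ge_1 by simp
    qed
    define \<eta> where "\<eta> = e / (\<Lambda> + 1)"
    have \<eta>: "\<eta> > 0" "\<Lambda> * \<eta> \<le> e" using e \<Lambda> by (auto simp: \<eta>_def field_simps)
    \<comment> \<open>For \<open>|t| \<le> T\<close> the margin \<open>H + T\<close> guarantees
      \<open>|t + h| > H\<close>, and the window \<open>T + T'\<close> contains all
      \<open>\<tau> - h\<close> with \<open>\<tau>\<close> within \<open>T'\<close> of
      \<open>t + h\<close>.\<close>
    have far: "norm (green_op g (t + h) - green_op g (t + h')) \<le> e"
      if R: "\<forall>\<sigma>. \<bar>\<sigma>\<bar> \<le> T + T' \<longrightarrow> dist (A (\<sigma> + h)) (A (\<sigma> + h')) \<le> d"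
        "\<forall>\<sigma>. \<bar>\<sigma>\<bar> \<le> T + T' \<longrightarrow> dist (g (\<sigma> + h)) (g (\<sigma> + h')) \<le> d"
        "H + T < \<bar>h\<bar>" "\<bar>t\<bar> \<le> T" for h h' t
    proof -
      have small: "norm (A \<tau> - A (\<tau> + (h' - h))) \<le> d \<and> norm (g \<tau> - g (\<tau> + (h' - h))) \<le> d"
        if "\<bar>\<tau> - (t + h)\<bar> \<le> T'" for \<tau>
        using R(1)[rule_format, of "\<tau> - h"] R(2)[rule_format, of "\<tau> - h"] R(4) that
        by (simp add: dist_norm algebra_simps)
      from green_op_translate_diff[OF g', where t = "t + h" and s = "h' - h" and d = d, OF small T'(1)]
      have "norm (green_op g (t + h) - green_op g (t + h')) \<le>
          exp (- \<nu> * \<bar>t + h\<bar>) * (N * (2 * M' + 2 * N / \<nu> * Mp)) +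
          (e / 3 + 4 * N / \<nu> * Mp * exp (- (\<nu> / 2) * T'))"
        unfolding M'_def[symmetric] Mp_def[symmetric] d(2) by (simp add: algebra_simps)
      moreover have "exp (- \<nu> * \<bar>t + h\<bar>) * (N * (2 * M' + 2 * N / \<nu> * Mp)) \<le>
          exp (- \<nu> * H) * (N * (2 * M' + 2 * N / \<nu> * Mp))"
        using R(3,4) \<nu>_pos N_ge_1 M' \<alpha> M0 by (intro mult_right_mono) (auto simp: Mp_def)
      ultimately show ?thesis using T'(2) H(2) by (simp add: mult.commute)
    qed
    have near: "norm (green_op g (t + h) - green_op g (t + h')) \<le> e" if "\<bar>h - h'\<bar> \<le> \<eta>" for h h' t
      using order.trans[OF green_op_lipschitz[OF g', of "t + h" "t + h'"],
          OF order.trans[OF mult_left_mono[OF _ \<Lambda>[unfolded \<Lambda>_def M'_def]] \<eta>(2)[unfolded \<Lambda>_def M'_def]]] that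
      by simp
    show "totally_bounded_rel (\<lambda>h h'. \<forall>t. \<bar>t\<bar> \<le> T0 \<longrightarrow>
        dist (green_op g (t + h)) (green_op g (t + h')) \<le> e)"
    proof (rule totally_bounded_rel_mono[OF totally_bounded_rel_conj[OF
          totally_bounded_rel_conj[OF lagrange_stable_imp_totally_bounded_rel[OF A d(1), of "T + T'"]
            lagrange_stable_imp_totally_bounded_rel[OF g d(1), of "T + T'"]]
          totally_bounded_rel_close_or_far[OF \<eta>(1), of "H + T"]]], intro allI impI, elim conjE)
      fix h h' t :: real
      assume "\<forall>\<sigma>. \<bar>\<sigma>\<bar> \<le> T + T' \<longrightarrow> dist (A (\<sigma> + h)) (A (\<sigma> + h')) \<le> d"
        "\<forall>\<sigma>. \<bar>\<sigma>\<bar> \<le> T + T' \<longrightarrow> dist (g (\<sigma> + h)) (g (\<sigma> + h')) \<le> d"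
        "(H + T < \<bar>h\<bar> \<and> H + T < \<bar>h'\<bar>) \<or> \<bar>h - h'\<bar> \<le> \<eta>" and "\<bar>t\<bar> \<le> T0"
      then show "dist (green_op g (t + h)) (green_op g (t + h')) \<le> e"
        using far[of h h' t] near[of h h' t] by (auto simp: dist_norm T_def)
    qed
  qed
qed

end

subsection \<open>The nonlinear equation\<close>

lemma closed_lagrange_stable:
  "closed {x :: real \<Rightarrow>\<^sub>C 'y::complete_space. lagrange_stable (apply_bcontfun x)}" (is "closed ?S")
proof -
  have "lagrange_stable (apply_bcontfun x)" if "x \<in> closure ?S" for x
  proof (rule lagrange_stable_uniform_limit)
    fix e :: real assume "e > 0"
    with that have "\<exists>y\<in>?S. dist y x < e"
      unfolding closure_approachable by blast
    then obtain y where "y \<in> ?S" "dist y x < e" by blast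
    then show "\<exists>\<psi>. lagrange_stable \<psi> \<and> (\<forall>t. dist (\<psi> t) (apply_bcontfun x t) \<le> e)"
      by (intro exI[of _ "apply_bcontfun y"])
        (auto intro: less_imp_le dist_fun_lt_imp_dist_val_lt)
  qed simp
  then have "closure ?S \<subseteq> ?S" by blast
  then show ?thesis by (simp add: closure_subset_eq)
qed

text \<open>The Green operator has norm at most \<open>2 * N / \<nu>\<close>, so the map has
  Lipschitz constant \<open>2 * N / \<nu> * L\<close>, and the bound on \<open>L\<close> says that
  this is below 1. The Lagrange stable functions form a complete invariant set, so stability comes
  with the fixed point.\<close>

lemma (in trichotomy) lagrange_stable_fixed_point:
  assumes A: "lagrange_stable A" and f: "lagrange_stable f"
    and F: "continuous_on UNIV F" "lagrange_stable2 F"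
    and lip: "\<And>t u v. norm (F (t, u) - F (t, v)) \<le> L * norm (u - v)"
    and L: "0 \<le> L" "L < \<nu> / (2 * N)"
  obtains \<phi> where "lagrange_stable \<phi>" "\<phi> = green_op (\<lambda>\<tau>. f \<tau> + F (\<tau>, \<phi> \<tau>))"
proof -
  let ?S = "{x :: real \<Rightarrow>\<^sub>C 'a. lagrange_stable (apply_bcontfun x)}"
  define g where "g x \<tau> = f \<tau> + F (\<tau>, apply_bcontfun x \<tau>)" for x \<tau>
  have g: "lagrange_stable (g x)" if "x \<in> ?S" for x
    unfolding g_def using that
    by (intro lagrange_stable_add f lagrange_stable_compose[OF F lip]) simp
  \<comment> \<open>The Green integral is shown to be bounded and continuous for Lagrange stable
    \<open>x\<close>, so \<open>\<Psi>\<close> is controlled on \<open>?S\<close> only.\<close>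
  define \<Psi> where "\<Psi> x = Bcontfun (green_op (g x))" for x
  have \<Psi>: "apply_bcontfun (\<Psi> x) = green_op (g x)" if "x \<in> ?S" for x
  proof -
    have "lagrange_stable (green_op (g x))"
      using lagrange_stable_green_op[OF A g[OF that]] .
    then obtain M where "\<And>t. norm (green_op (g x) t) \<le> M" "continuous_on UNIV (green_op (g x))"
      using lagrange_stable_bounded lagrange_stable_imp_continuous by metis
    then have "green_op (g x) \<in> bcontfun"
      using bcontfun_normI by blast
    then show ?thesis by (simp add: \<Psi>_def Bcontfun_inverse)
  qed
  have "\<exists>!x\<in>?S. \<Psi> x = x"
  proof (rule Banach_fix[where c = "2 * N / \<nu> * L"])
    show "complete ?S" by (simp add: complete_eq_closed closed_lagrange_stable)
    have "totally_bounded_rel (\<lambda>h h' :: real. True)"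
      by (rule totally_bounded_relI[of "{()}" "\<lambda>_ _. True"]) auto
    then have "0 \<in> ?S" by (simp add: lagrange_stable_iff)
    then show "?S \<noteq> {}" by blast
    show "0 \<le> 2 * N / \<nu> * L" using L(1) N_ge_1 \<nu>_pos by simp
    show "2 * N / \<nu> * L < 1" using L(2) N_ge_1 \<nu>_pos by (simp add: field_simps)
    show "\<Psi> ` ?S \<subseteq> ?S" using \<Psi> g lagrange_stable_green_op[OF A] by auto
    fix x y assume x: "x \<in> ?S" and y: "y \<in> ?S"
    obtain Mx where Mx: "\<And>t. norm (g x t) \<le> Mx" using lagrange_stable_bounded[OF g[OF x]] by blast
    obtain My where My: "\<And>t. norm (g y t) \<le> My" using lagrange_stable_bounded[OF g[OF y]] by blast
    note gx = lagrange_stable_imp_continuous[OF g[OF x]] Mx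
    note gy = lagrange_stable_imp_continuous[OF g[OF y]] My
    have le: "norm (g x \<tau> - g y \<tau>) \<le> L * dist x y" for \<tau>
      unfolding g_def using dist_bounded[of x \<tau> y] L(1)
      by (auto simp: dist_norm intro!: order.trans[OF lip] mult_left_mono)
    have "norm (green_op (g x) t - green_op (g y) t) \<le> 2 * N / \<nu> * (L * dist x y)" for t
      unfolding green_op_diff[OF gx gy]
      by (intro norm_green_op_le le continuous_on_diff gx gy)
    then show "dist (\<Psi> x) (\<Psi> y) \<le> 2 * N / \<nu> * L * dist x y"
      by (intro dist_bound) (simp add: \<Psi>[OF x] \<Psi>[OF y] dist_norm mult.assoc)
  qed
  then obtain x where x: "x \<in> ?S" "\<Psi> x = x" by blast
  have "apply_bcontfun x = green_op (g x)" using \<Psi>[OF x(1)] x(2) by simp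
  then show thesis
    using x(1) unfolding g_def by (intro that[of "apply_bcontfun x"]) auto
qed

text \<open>The radius results from two estimates: the fixed-point equation gives an a priori bound
  for the solution, and its difference from \<open>\<phi>0\<close> is the Green integral of
  \<open>F(\<tau>, \<phi>(\<tau>))\<close> alone.\<close>

theorem theorem6p19:
  fixes A :: "real \<Rightarrow> 'a::banach \<Rightarrow>\<^sub>L 'a"
    and f \<phi>0 :: "real \<Rightarrow> 'a"
    and F :: "real \<times> 'a \<Rightarrow> 'a"
    and P Q :: "'a \<Rightarrow>\<^sub>L 'a"
    and N \<nu> L r :: real
  assumes "continuous_on UNIV f" and "continuous_on UNIV F" and "continuous_on UNIV A"
    and "\<And>t. F (t, 0) = 0"
    and "exp_trichotomy A P Q N \<nu>"
    and "lagrange_stable A" and "lagrange_stable f" and "lagrange_stable2 F"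
    and "\<And>t u1 u2. norm (F (t, u1) - F (t, u2)) \<le> L * norm (u1 - u2)"
    and "L < \<nu> / (2 * N)"
    and "\<And>t. \<phi>0 t = integral UNIV (\<lambda>\<tau>. blinfun_apply (green A P Q t \<tau>) (f \<tau>))"
    and "r = 4 * N\<^sup>2 * L * sup_norm f / (\<nu> * (\<nu> - 2 * N * L))"
  shows "(\<forall>t. (\<lambda>\<tau>. blinfun_apply (green A P Q t \<tau>) (f \<tau>)) integrable_on UNIV) \<and>
    bounded (range \<phi>0) \<and>
    solves_on_reals \<phi>0 (\<lambda>t x. blinfun_apply (A t) x + f t) \<and>
    (\<exists>\<phi>. lagrange_stable \<phi> \<and>
      solves_on_reals \<phi> (\<lambda>t u. blinfun_apply (A t) u + f t + F (t, u)) \<and>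
      (\<forall>t. ((\<lambda>\<tau>. blinfun_apply (green A P Q t \<tau>) (f \<tau> + F (\<tau>, \<phi> \<tau>)))
              has_integral \<phi> t) UNIV) \<and>
      sup_norm (\<lambda>t. \<phi> t - \<phi>0 t) \<le> r)"
proof -
  obtain \<alpha> where "\<And>t. norm (A t) \<le> \<alpha>"
    using lagrange_stable_bounded[OF \<open>lagrange_stable A\<close>] by blast
  then interpret trichotomy A \<alpha> P Q N \<nu>
    using assms(3,5) by unfold_locales
  obtain Mf where Mf: "\<And>t. norm (f t) \<le> Mf"
    using lagrange_stable_bounded[OF \<open>lagrange_stable f\<close>] by blast
  have f_le: "norm (f t) \<le> sup_norm f" for t
    unfolding sup_norm_def using Mf by (intro cSUP_upper bdd_aboveI[of _ Mf]) auto
  note f = assms(1) f_le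
  have \<phi>0: "\<phi>0 = green_op f" using assms(11) by (simp add: green_op_def fun_eq_iff)
  \<comment> \<open>The contraction argument needs a nonnegative constant, whereas the sign of
    \<open>L\<close> is not prescribed; negative \<open>L\<close> is settled separately
    below.\<close>
  define L' where "L' = max L 0"
  have L': "0 \<le> L'" "L' < \<nu> / (2 * N)"
    using assms(10) \<nu>_pos N_ge_1 by (auto simp: L'_def)
  have lip: "norm (F (t, u) - F (t, v)) \<le> L' * norm (u - v)" for t u v
    using assms(9)[of t u v] mult_right_mono[of L L' "norm (u - v)"] by (simp add: L'_def)
  obtain \<phi> where \<phi>: "lagrange_stable \<phi>" "\<phi> = green_op (\<lambda>\<tau>. f \<tau> + F (\<tau>, \<phi> \<tau>))"
    using lagrange_stable_fixed_point[OF assms(6,7,2,8) lip L'] by blast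
  have F\<phi>: "lagrange_stable (\<lambda>t. F (t, \<phi> t))"
    by (rule lagrange_stable_compose[OF assms(2,8) lip \<phi>(1)])
  then have cont_F: "continuous_on UNIV (\<lambda>t. F (t, \<phi> t))"
    by (rule lagrange_stable_imp_continuous)
  obtain M where M: "\<And>t. norm (\<phi> t) \<le> M" using lagrange_stable_bounded[OF \<phi>(1)] by blast
  define n where "n = sup_norm \<phi>"
  have n: "norm (\<phi> t) \<le> n" for t
    unfolding n_def sup_norm_def using M by (intro cSUP_upper bdd_aboveI[of _ M]) auto
  have F_le: "norm (F (t, \<phi> t)) \<le> L' * n" for t
    using lip[of t "\<phi> t" 0] mult_left_mono[OF n[of t] L'(1)] assms(4) by simp
  define g where "g \<tau> = f \<tau> + F (\<tau>, \<phi> \<tau>)" for \<tau>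
  have g: "continuous_on UNIV g" "\<And>t. norm (g t) \<le> sup_norm f + L' * n"
    unfolding g_def by (auto intro!: continuous_on_add f cont_F norm_triangle_le add_mono F_le)
  have \<phi>_eq: "\<phi> = green_op g" using \<phi>(2) unfolding g_def[abs_def] .
  have "norm (\<phi> t) \<le> 2 * N / \<nu> * (sup_norm f + L' * n)" for t
    using norm_green_op_le[OF g, of t] by (simp only: \<phi>_eq[symmetric])
  \<comment> \<open>The bound contains \<open>n\<close> itself; since
    \<open>\<nu> - 2 * N * L'\<close> is positive, it can be solved for \<open>n\<close>.\<close>
  then have "n \<le> 2 * N / \<nu> * (sup_norm f + L' * n)"
    unfolding n_def sup_norm_def[of \<phi>] by (intro cSUP_least) simp_all
  then have n_le: "n * (\<nu> - 2 * N * L') \<le> 2 * N * sup_norm f"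
    using \<nu>_pos by (simp add: field_simps)
  have gap: "\<nu> - 2 * N * L' > 0" using L'(2) N_ge_1 by (simp add: field_simps)
  have bound: "norm (\<phi> t - \<phi>0 t) \<le> r" for t
  proof (cases "L \<ge> 0")
    case True
    then have "L' = L" by (simp add: L'_def)
    have "(\<lambda>\<tau>. g \<tau> - f \<tau>) = (\<lambda>\<tau>. F (\<tau>, \<phi> \<tau>))" by (simp add: g_def)
    then have "\<phi> t - \<phi>0 t = green_op (\<lambda>\<tau>. F (\<tau>, \<phi> \<tau>)) t"
      using green_op_diff[OF g f, of t] by (simp only: \<phi>_eq[symmetric] \<phi>0)
    also have "norm \<dots> \<le> 2 * N / \<nu> * (L' * n)"
      by (rule norm_green_op_le[OF cont_F F_le])
    also have "\<dots> \<le> 2 * N / \<nu> * (L' * (2 * N * sup_norm f / (\<nu> - 2 * N * L')))"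
      using n_le gap L'(1) N_ge_1 \<nu>_pos by (intro mult_left_mono) (auto simp: pos_le_divide_eq)
    also have "\<dots> = r"
      using \<open>L' = L\<close> by (simp add: assms(12) power2_eq_square)
    finally show ?thesis .
  next
    case False \<comment> \<open>a negative Lipschitz constant forces the space to be trivial\<close>
    have zero: "x = 0" for x :: 'a
    proof (rule ccontr)
      assume "x \<noteq> 0"
      then have "L * norm x < 0" using False by (simp add: mult_neg_pos)
      then show False using order.trans[OF norm_ge_zero assms(9)[of 0 x 0]] by simp
    qed
    have "sup_norm f = 0" unfolding sup_norm_def using zero[of "f t" for t] by simp
    then show ?thesis using zero[of "\<phi> t - \<phi>0 t"] by (simp add: assms(12))
  qed
  show ?thesis
  proof (intro conjI allI exI[of _ \<phi>])
    show "(\<lambda>\<tau>. green A P Q t \<tau> (f \<tau>)) integrable_on UNIV" for t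
      using green_op_has_integral[OF f] by (rule has_integral_integrable)
    show "bounded (range \<phi>0)"
      unfolding bounded_iff \<phi>0 using norm_green_op_le[OF f] by blast
    show "solves_on_reals \<phi>0 (\<lambda>t x. A t x + f t)"
      unfolding solves_on_reals_def \<phi>0 using green_op_derivative[OF f] by blast
    show "lagrange_stable \<phi>" by fact
    show "solves_on_reals \<phi> (\<lambda>t u. A t u + f t + F (t, u))"
      unfolding solves_on_reals_def using green_op_derivative[OF g, unfolded \<phi>_eq[symmetric]]
      by (simp add: g_def add.assoc)
    show "((\<lambda>\<tau>. green A P Q t \<tau> (f \<tau> + F (\<tau>, \<phi> \<tau>))) has_integral \<phi> t) UNIV" for t
      using green_op_has_integral[OF g, of t, unfolded \<phi>_eq[symmetric]] by (simp add: g_def)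
    show "sup_norm (\<lambda>t. \<phi> t - \<phi>0 t) \<le> r"
      unfolding sup_norm_def using bound by (intro cSUP_least) auto
  qed
qed

end
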